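(* There exists an absolute constant $C>0$ and an algorithm with the following guarantee. Let $k\ge2$, $n\ge1$, $\varepsilon\in(0,1]$, and let $P$ be a distribution on $[n]$ with $\mathrm{d_{TV}}(P,U_n)\ge\varepsilon$. Given $n,k,\varepsilon$, sample access to $P$, and sample access to distributions $D_1,\dots,D_k$ on $[n]$ each promised to be equal to $P$ or to $U_n$, the algorithm correctly classifies every $D_i$ as $P$ or $U_n$ with probability at least $8/9$, using in total (including samples from $P$) at most $C\frac{\sqrt{nk\log k}}{\varepsilon^2}$ samples if $n\ge k\log k$, and at most $C\frac{k\log k}{\varepsilon^2}$ samples if $n\le k\log k$.
   Context: $U_n$ is the uniform distribution on $[n]$; $\mathrm{d_{TV}}$ is total variation distance. Sample access means the algorithm may adaptively request independent samples from the distribution. *)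

theory Defs
  imports "HOL-Probability.Probability"
begin

text \<open>Adaptive (possibly randomized) sampling algorithms, modelled as decision trees.
  Sources are indexed by natural numbers: source 0 is the reference distribution P,
  sources 1..k are D_1..D_k.
  \<^item> Done out: stop, output classification out (out i = True means "D_i is P",
    out i = False means "D_i is U_n").
  \<^item> Query j f: draw one fresh independent sample x from source j, continue with f x.
  \<^item> Rand R f: internal randomness (costs no samples), draw r from R, continue with f r.\<close>

datatype alg = Done "nat \<Rightarrow> bool" | Query nat "nat \<Rightarrow> alg" | Rand "nat pmf" "nat \<Rightarrow> alg"

primrec run :: "(nat \<Rightarrow> nat pmf) \<Rightarrow> alg \<Rightarrow> ((nat \<Rightarrow> bool) \<times> nat) pmf" where
  "run src (Done out) = return_pmf (out, 0)"
| "run src (Query j f) =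
     bind_pmf (src j) (\<lambda>x. map_pmf (\<lambda>(out, c). (out, Suc c)) (run src (f x)))"
| "run src (Rand R f) = bind_pmf R (\<lambda>r. run src (f r))"

definition unif :: "nat \<Rightarrow> nat pmf" where
  "unif n = pmf_of_set {1..n}"

definition dTV :: "nat \<Rightarrow> nat pmf \<Rightarrow> nat pmf \<Rightarrow> real" where
  "dTV n p q = (1/2) * (\<Sum>x\<in>{1..n}. \<bar>pmf p x - pmf q x\<bar>)"

definition sources :: "nat \<Rightarrow> nat \<Rightarrow> nat pmf \<Rightarrow> (nat \<Rightarrow> bool) \<Rightarrow> nat \<Rightarrow> nat pmf" where
  "sources n k P b j = (if j = 0 then P else if j \<le> k \<and> b j then P else unif n)"

end

theory Submission
  imports Defs
begin

text \<open>
  Take R blocks of t \<open>\<le>\<close> n samples of P and let Q(x) be the fraction of blocks that miss x. The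
  mean of Q(x) is \<open>(1 - p\<^sub>x)\<^sup>t\<close>, a decreasing and bounded function of \<open>p\<^sub>x\<close>; boundedness is what
  makes heavy elements of P harmless. Hence the mean of Q under U exceeds its mean under P by a gap of
  order \<open>K = \<Sum> \<bar>\<delta>\<^sub>x\<bar> min (t \<bar>\<delta>\<^sub>x\<bar>) 1 \<ge> t \<epsilon>\<^sup>2 / n\<close>, with \<open>\<delta>\<^sub>x = p\<^sub>x - 1/n\<close>. By second moments, with
  constant probability the gap really is of order K, and the variance of Q under both P and U is
  \<open>O(K + t / (n R))\<close>. Once Q is fixed, a Bernstein bound shows that
  \<open>m = O(log k (n / (t \<epsilon>\<^sup>2) + n / (t R \<epsilon>\<^sup>4)))\<close> fresh samples of each source determine all its means up
  to a quarter of the gap, except with probability polynomially small in k, so one training set serves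
  all k sources. Balancing \<open>R t\<close> against \<open>k m\<close> gives the sample bound.
\<close>

section \<open>Concentration and non-adaptive algorithms\<close>

text \<open>Feeds the moment generating function bound below. For y = -z < 0, the identity (1 + z)(1
  - z + z^2) = 1 + z^3 bounds 1/(1 + z), and hence exp(-z), by the quadratic.\<close>

lemma exp_le_quadratic:
  fixes y :: real
  assumes "\<bar>y\<bar> \<le> 1"
  shows "exp y \<le> 1 + y + y\<^sup>2"
proof (cases "y \<ge> 0")
  case True
  then show ?thesis using exp_bound[of y] assms by simp
next
  case False
  define z where "z = - y"
  have z: "0 < z" "z \<le> 1" using False assms by (auto simp: z_def)
  have "(1 + z) * (1 - z + z\<^sup>2) = 1 + z ^ 3"
    by (simp add: algebra_simps power2_eq_square power3_eq_cube)
  then have "1 \<le> (1 + z) * (1 - z + z\<^sup>2)" using z by simp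
  then have "inverse (1 + z) \<le> 1 - z + z\<^sup>2" using z by (simp add: field_simps)
  moreover have "exp y \<le> inverse (1 + z)"
    using exp_ge_add_one_self[of z] z by (simp add: z_def exp_minus field_simps)
  ultimately show ?thesis by (simp add: z_def)
qed

lemma one_minus_exp_minus_ge:
  fixes y :: real
  assumes "0 \<le> y"
  shows "min y 1 / 2 \<le> 1 - exp (- y)"
proof -
  define m where "m = min y 1"
  have m: "0 \<le> m" "m \<le> 1" "m \<le> y" using assms by (auto simp: m_def)
  have "exp (- y) \<le> exp (- m)" using m by simp
  also have "\<dots> \<le> inverse (1 + m)"
    using exp_ge_add_one_self[of m] m by (simp add: exp_minus field_simps)
  also have "\<dots> \<le> 1 - m / 2"
    using m mult_left_mono[of m 1 m] by (simp add: field_simps)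
  finally show ?thesis by (simp add: m_def)
qed

lemma mult_exp_minus_le_one: "(y::real) * exp (- y) \<le> 1"
proof -
  have "y \<le> exp y" using exp_ge_add_one_self[of y] by linarith
  then show ?thesis by (simp add: exp_minus field_simps)
qed

section \<open>Tail bounds for product measures\<close>

lemma finite_set_Pi_pmf:
  assumes "finite I" "\<And>v. v \<in> I \<Longrightarrow> finite (set_pmf (p v))"
  shows "finite (set_pmf (Pi_pmf I d p))"
  using assms by (auto simp: set_Pi_pmf intro!: finite_PiE_dflt)

lemma markov_pmf:
  fixes f :: "'a \<Rightarrow> real"
  assumes fin: "finite (set_pmf p)" and a: "0 < a" and nn: "\<And>x. 0 \<le> f x"
  shows "measure_pmf.prob p {x. a \<le> f x} \<le> measure_pmf.expectation p f / a"
  using integral_Markov_inequality_measure[of "measure_pmf p" f UNIV a] assms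
  by (auto simp: integrable_measure_pmf_finite)

text \<open>Two-stage union bound: first-stage outcomes in \<open>B\<close> are charged in full, all
  others only their conditional failure probability. Training samples will be the first stage,
  evaluation samples the second.\<close>

lemma prob_bind_le:
  assumes "\<And>x. x \<in> set_pmf p \<Longrightarrow> x \<notin> B \<Longrightarrow> measure_pmf.prob (F x) S \<le> c" and c: "0 \<le> c"
  shows "measure_pmf.prob (bind_pmf p F) S \<le> measure_pmf.prob p B + c"
proof -
  have "emeasure (bind_pmf p F) S = (\<integral>\<^sup>+x. emeasure (F x) S \<partial>p)" by simp
  also have "\<dots> \<le> (\<integral>\<^sup>+x. indicator B x + ennreal c \<partial>p)"
  proof (rule nn_integral_mono_AE, unfold AE_measure_pmf_iff, intro ballI)
    fix x assume x: "x \<in> set_pmf p"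
    show "emeasure (F x) S \<le> indicator B x + ennreal c"
    proof (cases "x \<in> B")
      case True
      have "emeasure (F x) S \<le> 1" by (rule measure_pmf.emeasure_le_1)
      also have "\<dots> \<le> 1 + ennreal c" by simp
      finally show ?thesis using True by simp
    next
      case False
      then show ?thesis
        using assms(1)[OF x False] by (simp add: measure_pmf.emeasure_eq_measure ennreal_leI)
    qed
  qed
  also have "\<dots> = emeasure p B + ennreal c"
    by (subst nn_integral_add) (auto simp: measure_pmf.emeasure_space_1[simplified])
  also have "\<dots> = ennreal (measure_pmf.prob p B + c)"
    using c by (simp add: measure_pmf.emeasure_eq_measure ennreal_plus)
  finally show ?thesis
    using c by (simp add: measure_pmf.emeasure_eq_measure del: ennreal_plus)
qed

text \<open>Bernstein's exponential moment argument. The i.i.d. coordinates \<open>J\<close> sit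
  inside a larger product over \<open>I\<close> because samples of all sources live in one space;
  coordinates outside \<open>J\<close> contribute a factor 1.\<close>

lemma prob_iid_sum_ge:
  fixes Z :: "'b \<Rightarrow> real"
  assumes I: "finite I" "J \<subseteq> I" and fin: "\<And>v. v \<in> I \<Longrightarrow> finite (set_pmf (p v))"
    and D: "\<And>v. v \<in> J \<Longrightarrow> p v = D" and finD: "finite (set_pmf D)"
    and Z: "\<And>x. x \<in> set_pmf D \<Longrightarrow> \<bar>Z x\<bar> \<le> 1"
    and mean: "measure_pmf.expectation D Z = 0"
    and var: "measure_pmf.expectation D (\<lambda>x. (Z x)\<^sup>2) \<le> V"
    and h: "0 \<le> h" "h \<le> 2 * V" and V: "0 < V"
  shows "measure_pmf.prob (Pi_pmf I d p) {\<omega>. real (card J) * h \<le> (\<Sum>v\<in>J. Z (\<omega> v))}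
           \<le> exp (- (real (card J) * h\<^sup>2 / (4 * V)))"
proof -
  \<comment> \<open>Minimizes \<open>l\<^sup>2 * V - l * h\<close>; the assumption h \<le> 2V keeps
    l \<le> 1, so that the quadratic bound on exp applies.\<close>
  define l where "l = h / (2 * V)"
  have l: "0 \<le> l" "l \<le> 1" using h V by (auto simp: l_def)
  have int: "integrable (measure_pmf D) f" for f :: "'b \<Rightarrow> real"
    using finD by (rule integrable_measure_pmf_finite)
  have mgf: "measure_pmf.expectation D (\<lambda>x. exp (l * Z x)) \<le> exp (l\<^sup>2 * V)"
  proof -
    have "measure_pmf.expectation D (\<lambda>x. exp (l * Z x))
        \<le> measure_pmf.expectation D (\<lambda>x. 1 + l * Z x + l\<^sup>2 * (Z x)\<^sup>2)"
    proof (rule integral_mono_AE[OF int int], unfold AE_measure_pmf_iff, intro ballI)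
      fix x assume "x \<in> set_pmf D"
      then have "\<bar>l * Z x\<bar> \<le> 1"
        using l Z[of x] mult_mono[of l 1 "\<bar>Z x\<bar>" 1] by (simp add: abs_mult)
      from exp_le_quadratic[OF this]
      show "exp (l * Z x) \<le> 1 + l * Z x + l\<^sup>2 * (Z x)\<^sup>2" by (simp add: power_mult_distrib)
    qed
    also have "\<dots> = 1 + l\<^sup>2 * measure_pmf.expectation D (\<lambda>x. (Z x)\<^sup>2)"
      by (simp add: Bochner_Integration.integral_add int mean)
    also have "\<dots> \<le> 1 + l\<^sup>2 * V" using var by (simp add: mult_left_mono)
    also have "\<dots> \<le> exp (l\<^sup>2 * V)" by (rule exp_ge_add_one_self)
    finally show ?thesis .
  qed
  let ?M = "Pi_pmf I d p"
  have finM: "finite (set_pmf ?M)" using I fin by (intro finite_set_Pi_pmf)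
  have finJ: "finite J" using I finite_subset by blast
  let ?Y = "\<lambda>\<omega>. \<Prod>v\<in>I. if v \<in> J then exp (l * Z (\<omega> v)) else 1"
  have Y: "?Y \<omega> = exp (l * (\<Sum>v\<in>J. Z (\<omega> v)))" for \<omega>
    using I finJ
    by (simp add: prod.If_cases Int_absorb1 exp_sum sum_distrib_left)
  have "measure_pmf.expectation ?M ?Y
      = (\<Prod>v\<in>I. measure_pmf.expectation (p v) (\<lambda>x. if v \<in> J then exp (l * Z x) else 1))"
    using I fin
    by (intro expectation_prod_Pi_pmf[where f="\<lambda>v x. if v \<in> J then exp (l * Z x) else 1"])
      (auto intro!: integrable_measure_pmf_finite)
  also have "\<dots> = (\<Prod>v\<in>I. if v \<in> J then measure_pmf.expectation D (\<lambda>x. exp (l * Z x)) else 1)"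
    using D by (intro prod.cong) auto
  also have "\<dots> = measure_pmf.expectation D (\<lambda>x. exp (l * Z x)) ^ card J"
    using I finJ by (simp add: prod.If_cases Int_absorb1)
  also have "\<dots> \<le> exp (l\<^sup>2 * V) ^ card J"
    using mgf by (intro power_mono) auto
  also have "\<dots> = exp (real (card J) * (l\<^sup>2 * V))" by (simp add: exp_of_nat_mult)
  finally have EY: "measure_pmf.expectation ?M ?Y \<le> exp (real (card J) * (l\<^sup>2 * V))" .
  have "measure_pmf.prob ?M {\<omega>. real (card J) * h \<le> (\<Sum>v\<in>J. Z (\<omega> v))}
      \<le> measure_pmf.prob ?M {\<omega>. exp (l * (real (card J) * h)) \<le> ?Y \<omega>}"
    using l unfolding Y by (intro measure_pmf.finite_measure_mono) (auto intro: mult_left_mono)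
  also have "\<dots> \<le> measure_pmf.expectation ?M ?Y / exp (l * (real (card J) * h))"
    by (rule markov_pmf[OF finM]) (auto intro: prod_nonneg)
  also have "\<dots> \<le> exp (real (card J) * (l\<^sup>2 * V)) / exp (l * (real (card J) * h))"
    using EY by (intro divide_right_mono) auto
  also have "\<dots> = exp (real (card J) * (l\<^sup>2 * V) - l * (real (card J) * h))"
    by (simp add: exp_diff)
  also have "real (card J) * (l\<^sup>2 * V) - l * (real (card J) * h) = - (real (card J) * h\<^sup>2 / (4 * V))"
    using V by (simp add: l_def field_simps power2_eq_square)
  finally show ?thesis .
qed

text \<open>The second moment may be taken around any \<open>c\<close>, since the mean minimizes it.
  This allows the single centre \<open>q0\<close> for all sources, whatever their means.\<close>

lemma prob_iid_mean_deviation: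
  fixes g :: "'b \<Rightarrow> real"
  assumes I: "finite I" "J \<subseteq> I" "J \<noteq> {}" and fin: "\<And>v. v \<in> I \<Longrightarrow> finite (set_pmf (p v))"
    and D: "\<And>v. v \<in> J \<Longrightarrow> p v = D" and finD: "finite (set_pmf D)"
    and g: "\<And>x. 0 \<le> g x \<and> g x \<le> 1"
    and var: "measure_pmf.expectation D (\<lambda>x. (g x - c)\<^sup>2) \<le> V"
    and h: "0 \<le> h" "h \<le> 2 * V" and V: "0 < V"
  shows "measure_pmf.prob (Pi_pmf I d p)
           {\<omega>. h \<le> \<bar>(\<Sum>v\<in>J. g (\<omega> v)) / real (card J) - measure_pmf.expectation D g\<bar>}
           \<le> 2 * exp (- (real (card J) * h\<^sup>2 / (4 * V)))"
proof -
  let ?M = "Pi_pmf I d p" and ?m = "real (card J)"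
  define \<mu> where "\<mu> = measure_pmf.expectation D g"
  have int: "integrable (measure_pmf D) f" for f :: "'b \<Rightarrow> real"
    using finD by (rule integrable_measure_pmf_finite)
  have m: "?m > 0" using I finite_subset[OF I(2,1)] by (simp add: card_gt_0_iff)
  have \<mu>: "0 \<le> \<mu>" "\<mu> \<le> 1"
    unfolding \<mu>_def using g
    by (auto intro!: integral_nonneg_AE measure_pmf.integral_le_const int)
  have var': "measure_pmf.expectation D (\<lambda>x. (g x - \<mu>)\<^sup>2) \<le> V"
  proof -
    have "measure_pmf.expectation D (\<lambda>x. (g x - c)\<^sup>2)
        = measure_pmf.expectation D (\<lambda>x. (g x - \<mu>)\<^sup>2 + (2 * (\<mu> - c) * g x + (c\<^sup>2 - \<mu>\<^sup>2)))"
      by (intro Bochner_Integration.integral_cong) (auto simp: power2_eq_square algebra_simps)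
    also have "\<dots> = measure_pmf.expectation D (\<lambda>x. (g x - \<mu>)\<^sup>2) + (2 * (\<mu> - c) * \<mu> + (c\<^sup>2 - \<mu>\<^sup>2))"
      by (simp add: Bochner_Integration.integral_add int \<mu>_def[symmetric])
    also have "2 * (\<mu> - c) * \<mu> + (c\<^sup>2 - \<mu>\<^sup>2) = (\<mu> - c)\<^sup>2"
      by (simp add: power2_eq_square algebra_simps)
    finally show ?thesis using var zero_le_power2[of "\<mu> - c"] by linarith
  qed
  have A1: "measure_pmf.prob ?M {\<omega>. ?m * h \<le> (\<Sum>v\<in>J. g (\<omega> v) - \<mu>)} \<le> exp (- (?m * h\<^sup>2 / (4 * V)))"
  proof (rule prob_iid_sum_ge[OF I(1,2) fin D finD])
    fix x show "\<bar>g x - \<mu>\<bar> \<le> 1" using g[of x] \<mu> by linarith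
  qed (use var' h V in \<open>auto simp: int \<mu>_def\<close>)
  have A2: "measure_pmf.prob ?M {\<omega>. ?m * h \<le> (\<Sum>v\<in>J. \<mu> - g (\<omega> v))} \<le> exp (- (?m * h\<^sup>2 / (4 * V)))"
  proof (rule prob_iid_sum_ge[OF I(1,2) fin D finD])
    fix x show "\<bar>\<mu> - g x\<bar> \<le> 1" using g[of x] \<mu> by linarith
  qed (use var' h V in \<open>auto simp: int \<mu>_def power2_commute\<close>)
  have "{\<omega>. h \<le> \<bar>(\<Sum>v\<in>J. g (\<omega> v)) / ?m - \<mu>\<bar>}
      \<subseteq> {\<omega>. ?m * h \<le> (\<Sum>v\<in>J. g (\<omega> v) - \<mu>)} \<union> {\<omega>. ?m * h \<le> (\<Sum>v\<in>J. \<mu> - g (\<omega> v))}"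
    using m by (auto simp: sum_subtractf abs_real_def field_simps split: if_splits)
  then have "measure_pmf.prob ?M {\<omega>. h \<le> \<bar>(\<Sum>v\<in>J. g (\<omega> v)) / ?m - \<mu>\<bar>}
      \<le> measure_pmf.prob ?M ({\<omega>. ?m * h \<le> (\<Sum>v\<in>J. g (\<omega> v) - \<mu>)} \<union> {\<omega>. ?m * h \<le> (\<Sum>v\<in>J. \<mu> - g (\<omega> v))})"
    by (intro measure_pmf.finite_measure_mono) auto
  also have "\<dots> \<le> measure_pmf.prob ?M {\<omega>. ?m * h \<le> (\<Sum>v\<in>J. g (\<omega> v) - \<mu>)}
      + measure_pmf.prob ?M {\<omega>. ?m * h \<le> (\<Sum>v\<in>J. \<mu> - g (\<omega> v))}"
    by (rule measure_Un_le) auto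
  finally show ?thesis using A1 A2 by (simp add: \<mu>_def)
qed

section \<open>Non-adaptive algorithms\<close>

text \<open>Answers are stored under tags rather than in query order, so that they form one product
  measure; the initial value 0 agrees with the default value of \<open>Pi_pmf\<close> in
  \<open>run_query_all\<close>.\<close>

primrec query_all :: "('v \<Rightarrow> nat) \<Rightarrow> 'v list \<Rightarrow> (('v \<Rightarrow> nat) \<Rightarrow> nat \<Rightarrow> bool) \<Rightarrow> alg" where
  "query_all s [] F = Done (F (\<lambda>_. 0))"
| "query_all s (v # vs) F = Query (s v) (\<lambda>x. query_all s vs (\<lambda>\<omega>. F (fun_upd \<omega> v x)))"

lemma run_query_all:
  assumes "distinct vs"
  shows "run src (query_all s vs F)
    = map_pmf (\<lambda>\<omega>. (F \<omega>, length vs)) (Pi_pmf (set vs) 0 (\<lambda>v. src (s v)))"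
  using assms
proof (induction vs arbitrary: F)
  case (Cons v vs)
  then show ?case
    by (simp add: Pi_pmf_insert' map_bind_pmf map_pmf_comp map_pmf_def bind_assoc_pmf bind_return_pmf)
qed (simp add: map_return_pmf)

section \<open>Miss rates of sample blocks\<close>

text \<open>With l = n - 1, the reciprocal of 1 - 1/n is 1 + 1/l, whose l-th power is at most e
  \<le> 3; the one remaining factor is at least 1/2.\<close>

lemma one_minus_inverse_power_ge:
  assumes "2 \<le> n"
  shows "1 / 6 \<le> (1 - 1 / real n) ^ n"
proof -
  obtain l where n: "n = Suc l" and l: "1 \<le> l" using assms by (cases n) auto
  define b where "b = 1 - 1 / real n"
  have b: "b = inverse (1 + 1 / real l)" "1 / 2 \<le> b"
    using l by (auto simp: b_def n field_simps)
  have "(1 + 1 / real l) ^ l \<le> exp (1 / real l) ^ l"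
    using l by (intro power_mono exp_ge_add_one_self) (auto intro: add_nonneg_nonneg)
  also have "\<dots> = exp 1" using l by (simp add: exp_of_nat_mult[symmetric])
  also have "\<dots> \<le> 3" by (rule exp_le)
  finally have "1 / 3 \<le> b ^ l"
    using l by (simp add: b(1) power_inverse field_simps)
  then have "1 / 2 * (1 / 3) \<le> b * b ^ l" using b(2) by (intro mult_mono) auto
  then show ?thesis by (simp add: b_def n)
qed

section \<open>The miss probability as a function of the point mass\<close>

text \<open>Order of magnitude, for t \<le> n, of the change of \<open>(1 - p) ^ t\<close> when p
  moves away from 1/n by \<open>d\<close>: linear at first, saturating at 1 because probabilities
  do.\<close>

definition clip :: "nat \<Rightarrow> real \<Rightarrow> real" where
  "clip t d = min (real t * \<bar>d\<bar>) 1"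

lemma clip_nonneg: "0 \<le> clip t d"
  by (simp add: clip_def)

lemma clip_le: "clip t d \<le> 1" "clip t d \<le> real t * \<bar>d\<bar>"
  by (auto simp: clip_def)

lemma miss_gap_le:
  assumes "0 \<le> p" "p \<le> 1" "0 \<le> s" "s \<le> 1"
  shows "\<bar>(1 - p) ^ t - (1 - s) ^ t\<bar> \<le> clip t (p - s)"
proof -
  have "\<bar>(1 - p) ^ t - (1 - s) ^ t\<bar> \<le> real t * \<bar>(1 - p) - (1 - s)\<bar>"
    using norm_power_diff[of "1 - p" "1 - s" t] assms by simp
  moreover have "0 \<le> (1 - p) ^ t" "(1 - p) ^ t \<le> 1" "0 \<le> (1 - s) ^ t" "(1 - s) ^ t \<le> 1"
    using assms by (auto intro: power_le_one)
  ultimately show ?thesis by (auto simp: clip_def abs_minus_commute)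
qed

text \<open>Both factors on the right have the same sign, so absolute values can be compared. With t
  \<le> n the factor \<open>b ^ t\<close> stays above 1/6, and the relative change is at least half
  the clip; hence 12 = 6 * 2.\<close>

lemma miss_gap_ge:
  assumes n: "2 \<le> n" and t: "t \<le> n" and p: "0 \<le> p" "p \<le> 1"
  shows "\<bar>p - 1 / real n\<bar> * clip t (p - 1 / real n) / 12
    \<le> (p - 1 / real n) * ((1 - 1 / real n) ^ t - (1 - p) ^ t)"
proof -
  define d where "d = p - 1 / real n"
  define b where "b = 1 - 1 / real n"
  have b: "0 < b" "b \<le> 1" using n by (auto simp: b_def)
  have "1 / 6 \<le> b ^ n" using one_minus_inverse_power_ge[OF n] by (simp add: b_def)
  also have "b ^ n \<le> b ^ t" using t b by (intro power_decreasing) auto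
  finally have bt: "1 / 6 \<le> b ^ t" .
  have pd: "1 - p = b - d" by (simp add: b_def d_def)
  have "\<bar>d\<bar> * (clip t d / 12) \<le> \<bar>d\<bar> * \<bar>b ^ t - (b - d) ^ t\<bar>"
  proof (rule mult_left_mono)
    show "clip t d / 12 \<le> \<bar>b ^ t - (b - d) ^ t\<bar>"
    proof (cases "d \<ge> 0")
      case True
      \<comment> \<open>For a heavier point, b \<le> 1 gives b - d \<le> b (1 - d) \<le> b exp(-d),
        so the relative loss is at least 1 - exp(-td).\<close>
      have "(b - d) ^ t \<le> (b * exp (- d)) ^ t"
      proof (rule power_mono)
        have "b - d \<le> b * (1 - d)" using b True mult_right_mono[of b 1 d] by (simp add: algebra_simps)
        also have "\<dots> \<le> b * exp (- d)" using b exp_ge_add_one_self[of "- d"] by (intro mult_left_mono) auto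
        finally show "b - d \<le> b * exp (- d)" .
      qed (use p pd in simp)
      also have "\<dots> = b ^ t * exp (- (real t * d))"
        by (simp add: power_mult_distrib exp_of_nat_mult[symmetric])
      finally have "b ^ t * (1 - exp (- (real t * d))) \<le> b ^ t - (b - d) ^ t"
        by (simp add: algebra_simps)
      moreover have "1 / 6 * (clip t d / 2) \<le> b ^ t * (1 - exp (- (real t * d)))"
        using bt one_minus_exp_minus_ge[of "real t * d"] True
        by (intro mult_mono) (auto simp: clip_def)
      ultimately show ?thesis by linarith
    next
      case False
      \<comment> \<open>For a lighter point, b - d = b (1 + u) and Bernoulli's inequality gives a
        relative gain of at least tu.\<close>
      define u where "u = - d / b"
      have u: "- d \<le> u" "0 \<le> u"
        using b False mult_right_mono[of b 1 "- d"] by (auto simp: u_def field_simps)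
      have "b ^ t * (1 + real t * u) \<le> b ^ t * (1 + u) ^ t"
        using b u by (intro mult_left_mono Bernoulli_inequality) auto
      also have "\<dots> = (b - d) ^ t"
        using b by (simp add: power_mult_distrib[symmetric] u_def field_simps)
      finally have "b ^ t * (real t * u) \<le> (b - d) ^ t - b ^ t" by (simp add: algebra_simps)
      moreover have "1 / 6 * (real t * - d) \<le> b ^ t * (real t * u)"
        using bt u False by (intro mult_mono mult_left_mono) (auto intro: mult_nonneg_nonpos)
      moreover have "clip t d \<le> real t * - d" using clip_le(2)[of t d] False by simp
      ultimately show ?thesis using clip_nonneg[of t d] by linarith
    qed
  qed simp
  also have "\<bar>d\<bar> * \<bar>b ^ t - (b - d) ^ t\<bar> = d * (b ^ t - (b - d) ^ t)"
  proof (cases "d \<ge> 0")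
    case True
    then have "(b - d) ^ t \<le> b ^ t" using p pd by (intro power_mono) auto
    then show ?thesis using True by simp
  next
    case False
    then have "b ^ t \<le> (b - d) ^ t" using b by (intro power_mono) auto
    then show ?thesis using False by (simp add: algebra_simps)
  qed
  finally show ?thesis by (simp add: d_def b_def)
qed

text \<open>Large masses are harmless: q \<le> exp(-tp) makes tpq at most 1, and t/n \<le> 1 handles
  the rest, so the left side is at most 2. The trivial bound q (1 - q) \<le> 1 gives the linear
  branch of the clip.\<close>

lemma miss_variance_le:
  assumes t: "t \<le> n" "1 \<le> n" and p: "0 \<le> p" "p \<le> 1"
  shows "real t * \<bar>p - 1 / real n\<bar> * ((1 - p) ^ t * (1 - (1 - p) ^ t)) \<le> 2 * clip t (p - 1 / real n)"
proof -
  define q where "q = (1 - p) ^ t"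
  have q: "0 \<le> q" "q \<le> 1" using p by (auto simp: q_def intro: power_le_one)
  have "q \<le> exp (- p) ^ t"
    unfolding q_def using p exp_ge_add_one_self[of "- p"] by (intro power_mono) auto
  then have qe: "q \<le> exp (- (real t * p))" by (simp add: exp_of_nat_mult[symmetric])
  have "real t * \<bar>p - 1 / real n\<bar> * q \<le> real t * (p + 1 / real n) * q"
    using p q by (intro mult_right_mono mult_left_mono) (auto simp: abs_le_iff)
  also have "\<dots> = real t * p * q + real t / real n * q" by (simp add: algebra_simps)
  also have "\<dots> \<le> real t * p * exp (- (real t * p)) + 1 * 1"
    using p q qe t by (intro add_mono mult_mono) auto
  also have "\<dots> \<le> 2" using mult_exp_minus_le_one[of "real t * p"] by simp
  finally have A: "real t * \<bar>p - 1 / real n\<bar> * q \<le> 2" .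
  have q1: "q * (1 - q) \<le> q" "q * (1 - q) \<le> 1" "0 \<le> q * (1 - q)"
    using q mult_left_mono[of "1 - q" 1 q] by auto
  have "real t * \<bar>p - 1 / real n\<bar> * (q * (1 - q)) \<le> real t * \<bar>p - 1 / real n\<bar> * q"
    by (rule mult_left_mono[OF q1(1)]) simp
  moreover have "real t * \<bar>p - 1 / real n\<bar> * (q * (1 - q)) \<le> real t * \<bar>p - 1 / real n\<bar> * 1"
    by (rule mult_left_mono[OF q1(2)]) simp
  moreover have "0 \<le> real t * \<bar>p - 1 / real n\<bar>" by simp
  ultimately have "real t * \<bar>p - 1 / real n\<bar> * (q * (1 - q)) \<le> 2 * clip t (p - 1 / real n)"
    using A unfolding clip_def by linarith
  then show ?thesis by (simp add: q_def)
qed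

section \<open>Moments of the empirical miss rates\<close>

text \<open>Absence from a block is written as a product of indicators so that its expectation
  factors over the coordinates of a product measure.\<close>

definition miss_rate :: "(nat \<Rightarrow> 'v set) \<Rightarrow> nat \<Rightarrow> ('v \<Rightarrow> nat) \<Rightarrow> nat \<Rightarrow> real" where
  "miss_rate B R \<omega> x = (\<Sum>r\<in>{1..R}. \<Prod>v\<in>B r. of_bool (\<omega> v \<noteq> x)) / real R"

lemma miss_rate_bounds: "0 \<le> miss_rate B R \<omega> x" "miss_rate B R \<omega> x \<le> 1"
proof -
  show "0 \<le> miss_rate B R \<omega> x"
    unfolding miss_rate_def by (intro divide_nonneg_nonneg sum_nonneg prod_nonneg) auto
  have "(\<Sum>r\<in>{1..R}. \<Prod>v\<in>B r. of_bool (\<omega> v \<noteq> x)) \<le> (\<Sum>r\<in>{1..R}. 1::real)"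
    by (intro sum_mono prod_le_1) auto
  then show "miss_rate B R \<omega> x \<le> 1"
    unfolding miss_rate_def by (cases "R = 0") (auto simp: field_simps)
qed

text \<open>The avoided set may depend on the coordinate, so that two disjoint blocks avoiding
  different points are covered by one product.\<close>

lemma expectation_avoid:
  fixes P :: "nat pmf"
  assumes "finite I" "B \<subseteq> I"
  shows "measure_pmf.expectation (Pi_pmf I d (\<lambda>_. P)) (\<lambda>\<omega>. \<Prod>v\<in>B. of_bool (\<omega> v \<notin> A v) :: real)
    = (\<Prod>v\<in>B. 1 - measure_pmf.prob P (A v))"
proof -
  \<comment> \<open>Outside \<open>B\<close> the avoided set is empty, which extends the product to
    all of \<open>I\<close>.\<close>
  have "(\<Prod>v\<in>B. of_bool (\<omega> v \<notin> A v)) = (\<Prod>v\<in>I. indicator (- (if v \<in> B then A v else {})) (\<omega> v) :: real)"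
    for \<omega> :: "'a \<Rightarrow> nat"
    using assms by (intro prod.mono_neutral_cong_left) (auto simp: indicator_def)
  then have "measure_pmf.expectation (Pi_pmf I d (\<lambda>_. P)) (\<lambda>\<omega>. \<Prod>v\<in>B. of_bool (\<omega> v \<notin> A v) :: real)
    = (\<Prod>v\<in>I. measure_pmf.expectation P (indicator (- (if v \<in> B then A v else {}))))"
    using assms expectation_prod_Pi_pmf[of I "\<lambda>_. P"
        "\<lambda>v. indicator (- (if v \<in> B then A v else {}))" d]
    by (simp add: measure_pmf.integrable_const_bound[where B=1])
  also have "\<dots> = (\<Prod>v\<in>I. 1 - measure_pmf.prob P (if v \<in> B then A v else {}))"
    by (intro prod.cong refl) (simp add: measure_pmf.prob_compl[of _ P, simplified] Compl_eq_Diff_UNIV)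
  also have "\<dots> = (\<Prod>v\<in>B. 1 - measure_pmf.prob P (A v))"
    using assms by (intro prod.mono_neutral_cong_right) auto
  finally show ?thesis .
qed

locale blocks =
  fixes I :: "'v set" and B :: "nat \<Rightarrow> 'v set" and R t :: nat and P :: "nat pmf" and d :: nat
  assumes finite_I: "finite I" and finite_P: "finite (set_pmf P)"
    and block_subset: "\<And>r. r \<in> {1..R} \<Longrightarrow> B r \<subseteq> I"
    and block_card: "\<And>r. r \<in> {1..R} \<Longrightarrow> card (B r) = t"
    and block_disjoint: "\<And>r s. r \<in> {1..R} \<Longrightarrow> s \<in> {1..R} \<Longrightarrow> r \<noteq> s \<Longrightarrow> B r \<inter> B s = {}"
    and R_pos: "1 \<le> R"
begin

abbreviation "M \<equiv> Pi_pmf I d (\<lambda>_. P)"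
abbreviation "Q \<equiv> miss_rate B R"
definition "q x = (1 - pmf P x) ^ t"

lemma q_bounds: "0 \<le> q x" "q x \<le> 1"
  by (auto simp: q_def pmf_le_1 intro: power_le_one)

lemma integrable_M [simp]: "integrable (measure_pmf M) (f :: _ \<Rightarrow> real)"
  using finite_I finite_P by (intro integrable_measure_pmf_finite finite_set_Pi_pmf)

lemma finite_block: "r \<in> {1..R} \<Longrightarrow> finite (B r)"
  using block_subset finite_I finite_subset by blast

lemma expectation_block:
  assumes "r \<in> {1..R}"
  shows "measure_pmf.expectation M (\<lambda>\<omega>. \<Prod>v\<in>B r. of_bool (\<omega> v \<noteq> x) :: real) = q x"
  using expectation_avoid[OF finite_I block_subset[OF assms], of d P "\<lambda>_. {x}"] block_card[OF assms]
  by (simp add: q_def measure_pmf_single)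

text \<open>Disjoint blocks are independent and give exactly \<open>q x * q y\<close>. Within one
  block, x = y gives q = q^2 + q (1 - q), and for x \<noteq> y the bound comes from 1 - a - b \<le>
  (1 - a)(1 - b).\<close>

lemma expectation_block_pair:
  assumes r: "r \<in> {1..R}" and s: "s \<in> {1..R}"
  shows "measure_pmf.expectation M
      (\<lambda>\<omega>. (\<Prod>v\<in>B r. of_bool (\<omega> v \<noteq> x)) * (\<Prod>v\<in>B s. of_bool (\<omega> v \<noteq> y)) :: real)
    \<le> q x * q y + of_bool (r = s \<and> x = y) * (q x * (1 - q x))"
proof (cases "r = s")
  case False
  have dis: "B r \<inter> B s = {}" using block_disjoint r s False by blast
  define A where "A v = (if v \<in> B r then {x} else {y})" for v
  have prod: "(\<Prod>v\<in>B r \<union> B s. f v (A v)) = (\<Prod>v\<in>B r. f v {x}) * (\<Prod>v\<in>B s. f v {y})"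
    for f :: "'v \<Rightarrow> nat set \<Rightarrow> real"
  proof -
    have "(\<Prod>v\<in>B r \<union> B s. f v (A v)) = (\<Prod>v\<in>B r. f v (A v)) * (\<Prod>v\<in>B s. f v (A v))"
      using dis finite_block r s by (intro prod.union_disjoint) auto
    moreover have "(\<Prod>v\<in>B s. f v (A v)) = (\<Prod>v\<in>B s. f v {y})"
      using dis by (intro prod.cong) (auto simp: A_def)
    ultimately show ?thesis by (simp add: A_def)
  qed
  have "measure_pmf.expectation M (\<lambda>\<omega>. \<Prod>v\<in>B r \<union> B s. of_bool (\<omega> v \<notin> A v) :: real)
      = (\<Prod>v\<in>B r \<union> B s. 1 - measure_pmf.prob P (A v))"
    using block_subset[OF r] block_subset[OF s] finite_I by (intro expectation_avoid) auto
  then have "measure_pmf.expectation M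
      (\<lambda>\<omega>. (\<Prod>v\<in>B r. of_bool (\<omega> v \<noteq> x)) * (\<Prod>v\<in>B s. of_bool (\<omega> v \<noteq> y)) :: real) = q x * q y"
    using prod[of "\<lambda>v S. 1 - measure_pmf.prob P S"] prod[of "\<lambda>v S. of_bool (_ v \<notin> S)"]
      block_card r s
    by (simp add: q_def measure_pmf_single)
  then show ?thesis using False by simp
next
  case True
  have "(\<Prod>v\<in>B r. of_bool (\<omega> v \<noteq> x)) * (\<Prod>v\<in>B s. of_bool (\<omega> v \<noteq> y))
      = (\<Prod>v\<in>B r. of_bool (\<omega> v \<notin> {x, y}) :: real)" for \<omega>
    unfolding True prod.distrib[symmetric] by (intro prod.cong) auto
  then have E: "measure_pmf.expectation M
      (\<lambda>\<omega>. (\<Prod>v\<in>B r. of_bool (\<omega> v \<noteq> x)) * (\<Prod>v\<in>B s. of_bool (\<omega> v \<noteq> y)) :: real)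
      = (1 - measure_pmf.prob P {x, y}) ^ t"
    using expectation_avoid[OF finite_I block_subset[OF r], of d P "\<lambda>_. {x, y}"] block_card[OF r]
    by simp
  show ?thesis
  proof (cases "x = y")
    case True
    then show ?thesis using \<open>r = s\<close> unfolding E
      by (simp add: measure_pmf_single q_def algebra_simps)
  next
    case False
    have "measure_pmf.prob P {x, y} = pmf P x + pmf P y"
      using False by (simp add: measure_measure_pmf_finite)
    moreover have "1 - (pmf P x + pmf P y) \<le> (1 - pmf P x) * (1 - pmf P y)"
      using pmf_nonneg[of P x] pmf_nonneg[of P y] by (simp add: algebra_simps)
    moreover have "measure_pmf.prob P {x, y} \<le> 1" by simp
    ultimately have "(1 - measure_pmf.prob P {x, y}) ^ t \<le> ((1 - pmf P x) * (1 - pmf P y)) ^ t"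
      by (intro power_mono) auto
    then show ?thesis using False unfolding E by (simp add: q_def power_mult_distrib)
  qed
qed

lemma expectation_miss_rate: "measure_pmf.expectation M (\<lambda>\<omega>. Q \<omega> x) = q x"
  using R_pos by (simp add: miss_rate_def expectation_block)

text \<open>Within a block the events of missing two different points are negatively correlated.\<close>

lemma covariance_miss_rate:
  "measure_pmf.expectation M (\<lambda>\<omega>. (Q \<omega> x - q x) * (Q \<omega> y - q y))
    \<le> of_bool (x = y) * (q x * (1 - q x) / real R)"
proof -
  let ?e = "\<lambda>r s. measure_pmf.expectation M
      (\<lambda>\<omega>. (\<Prod>v\<in>B r. of_bool (\<omega> v \<noteq> x)) * (\<Prod>v\<in>B s. of_bool (\<omega> v \<noteq> y)) :: real)"
  have R: "real R > 0" using R_pos by simp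
  have EQ: "measure_pmf.expectation M (\<lambda>\<omega>. Q \<omega> x * Q \<omega> y)
      = (\<Sum>r\<in>{1..R}. \<Sum>s\<in>{1..R}. ?e r s) / (real R)\<^sup>2"
    by (simp add: miss_rate_def sum_product power2_eq_square)
  have "(\<Sum>r\<in>{1..R}. \<Sum>s\<in>{1..R}. ?e r s)
      \<le> (\<Sum>r\<in>{1..R}. \<Sum>s\<in>{1..R}. q x * q y + of_bool (r = s) * (of_bool (x = y) * (q x * (1 - q x))))"
  proof (intro sum_mono)
    fix r s assume "r \<in> {1..R}" "s \<in> {1..R}"
    from expectation_block_pair[OF this, of x y]
    show "?e r s \<le> q x * q y + of_bool (r = s) * (of_bool (x = y) * (q x * (1 - q x)))"
      by (simp only: of_bool_conj mult.assoc)
  qed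
  also have "\<dots> = (\<Sum>r\<in>{1..R}. real R * (q x * q y) + of_bool (x = y) * (q x * (1 - q x)))"
  proof (rule sum.cong[OF refl])
    fix r assume r: "r \<in> {1..R}"
    have "(\<Sum>s\<in>{1..R}. of_bool (r = s) * c) = c" for c :: real
    proof -
      have "(\<Sum>s\<in>{1..R}. of_bool (r = s) * c) = (\<Sum>s\<in>{1..R}. if r = s then c else 0)"
        by (intro sum.cong) auto
      then show ?thesis using r by simp
    qed
    then show "(\<Sum>s\<in>{1..R}. q x * q y + of_bool (r = s) * (of_bool (x = y) * (q x * (1 - q x))))
      = real R * (q x * q y) + of_bool (x = y) * (q x * (1 - q x))"
      by (simp only: sum.distrib) simp
  qed
  also have "\<dots> = real R * (real R * (q x * q y) + of_bool (x = y) * (q x * (1 - q x)))"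
    by simp
  finally have "measure_pmf.expectation M (\<lambda>\<omega>. Q \<omega> x * Q \<omega> y)
      \<le> real R * (real R * (q x * q y) + of_bool (x = y) * (q x * (1 - q x))) / (real R)\<^sup>2"
    unfolding EQ by (rule divide_right_mono) simp
  also have "\<dots> = q x * q y + of_bool (x = y) * (q x * (1 - q x) / real R)"
    using R by (simp add: field_simps power2_eq_square)
  finally have *: "measure_pmf.expectation M (\<lambda>\<omega>. Q \<omega> x * Q \<omega> y)
      \<le> q x * q y + of_bool (x = y) * (q x * (1 - q x) / real R)" .
  have "measure_pmf.expectation M (\<lambda>\<omega>. (Q \<omega> x - q x) * (Q \<omega> y - q y))
      = measure_pmf.expectation M (\<lambda>\<omega>. Q \<omega> x * Q \<omega> y - q y * Q \<omega> x - q x * Q \<omega> y + q x * q y)"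
    by (intro Bochner_Integration.integral_cong) (auto simp: algebra_simps)
  also have "\<dots> = measure_pmf.expectation M (\<lambda>\<omega>. Q \<omega> x * Q \<omega> y) - q x * q y"
    by (simp add: expectation_miss_rate)
  finally show ?thesis using * by linarith
qed

lemma second_moment_linear_nonneg:
  assumes "finite X" "\<And>x. x \<in> X \<Longrightarrow> 0 \<le> w x"
  shows "measure_pmf.expectation M (\<lambda>\<omega>. (\<Sum>x\<in>X. w x * (Q \<omega> x - q x))\<^sup>2)
    \<le> (\<Sum>x\<in>X. (w x)\<^sup>2 * (q x * (1 - q x))) / real R"
proof -
  have "measure_pmf.expectation M (\<lambda>\<omega>. (\<Sum>x\<in>X. w x * (Q \<omega> x - q x))\<^sup>2)
      = measure_pmf.expectation M (\<lambda>\<omega>. \<Sum>x\<in>X. \<Sum>y\<in>X. w x * w y * ((Q \<omega> x - q x) * (Q \<omega> y - q y)))"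
    by (intro Bochner_Integration.integral_cong) (auto simp: power2_eq_square sum_product mult_ac)
  also have "\<dots> = (\<Sum>x\<in>X. \<Sum>y\<in>X. w x * w y * measure_pmf.expectation M (\<lambda>\<omega>. (Q \<omega> x - q x) * (Q \<omega> y - q y)))"
    by simp
  also have "\<dots> \<le> (\<Sum>x\<in>X. \<Sum>y\<in>X. w x * w y * (of_bool (x = y) * (q x * (1 - q x) / real R)))"
    using assms by (intro sum_mono mult_left_mono covariance_miss_rate) auto
  also have "\<dots> = (\<Sum>x\<in>X. (w x)\<^sup>2 * (q x * (1 - q x) / real R))"
  proof (rule sum.cong[OF refl])
    fix x assume "x \<in> X"
    then have "(\<Sum>y\<in>X. w x * w y * (of_bool (x = y) * (q x * (1 - q x) / real R)))
      = (\<Sum>y\<in>X. if x = y then (w x)\<^sup>2 * (q x * (1 - q x) / real R) else 0)"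
      by (intro sum.cong) (auto simp: power2_eq_square)
    then show "(\<Sum>y\<in>X. w x * w y * (of_bool (x = y) * (q x * (1 - q x) / real R)))
      = (w x)\<^sup>2 * (q x * (1 - q x) / real R)"
      using \<open>x \<in> X\<close> assms by simp
  qed
  also have "\<dots> = (\<Sum>x\<in>X. (w x)\<^sup>2 * (q x * (1 - q x))) / real R"
    by (simp add: sum_divide_distrib)
  finally show ?thesis .
qed

text \<open>Signed weights are split into positive and negative parts at the cost of a factor 2. The
  parts have disjoint supports, so their squares add up to those of \<open>w\<close>.\<close>

lemma second_moment_linear:
  assumes "finite X"
  shows "measure_pmf.expectation M (\<lambda>\<omega>. (\<Sum>x\<in>X. w x * (Q \<omega> x - q x))\<^sup>2)
    \<le> 2 * (\<Sum>x\<in>X. (w x)\<^sup>2 * (q x * (1 - q x))) / real R"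
proof -
  let ?S = "\<lambda>w \<omega>. (\<Sum>x\<in>X. w x * (Q \<omega> x - q x))"
  let ?p = "\<lambda>x. max (w x) 0" and ?m = "\<lambda>x. max (- w x) 0"
  have sq: "(?S w \<omega>)\<^sup>2 \<le> 2 * (?S ?p \<omega>)\<^sup>2 + 2 * (?S ?m \<omega>)\<^sup>2" for \<omega>
  proof -
    have "?S w \<omega> = ?S ?p \<omega> - ?S ?m \<omega>"
      unfolding sum_subtractf[symmetric] by (intro sum.cong) (auto simp: max_def)
    moreover have "(a - b)\<^sup>2 \<le> 2 * a\<^sup>2 + 2 * b\<^sup>2" for a b :: real
      using zero_le_power2[of "a + b"] by (simp add: power2_eq_square algebra_simps)
    ultimately show ?thesis by presburger
  qed
  have "measure_pmf.expectation M (\<lambda>\<omega>. (?S w \<omega>)\<^sup>2)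
      \<le> measure_pmf.expectation M (\<lambda>\<omega>. 2 * (?S ?p \<omega>)\<^sup>2 + 2 * (?S ?m \<omega>)\<^sup>2)"
    by (intro integral_mono sq integrable_M)
  also have "\<dots> = 2 * measure_pmf.expectation M (\<lambda>\<omega>. (?S ?p \<omega>)\<^sup>2) + 2 * measure_pmf.expectation M (\<lambda>\<omega>. (?S ?m \<omega>)\<^sup>2)"
    by simp
  also have "\<dots> \<le> 2 * ((\<Sum>x\<in>X. (?p x)\<^sup>2 * (q x * (1 - q x))) / real R)
      + 2 * ((\<Sum>x\<in>X. (?m x)\<^sup>2 * (q x * (1 - q x))) / real R)"
    by (intro add_mono mult_left_mono second_moment_linear_nonneg assms) auto
  also have "\<dots> = 2 * (\<Sum>x\<in>X. (?p x)\<^sup>2 * (q x * (1 - q x)) + (?m x)\<^sup>2 * (q x * (1 - q x))) / real R"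
    by (simp add: sum.distrib add_divide_distrib)
  also have "(\<Sum>x\<in>X. (?p x)\<^sup>2 * (q x * (1 - q x)) + (?m x)\<^sup>2 * (q x * (1 - q x)))
      = (\<Sum>x\<in>X. (w x)\<^sup>2 * (q x * (1 - q x)))"
    by (intro sum.cong) (auto simp: max_def)
  finally show ?thesis .
qed

end

section \<open>Gap and variance for a distribution far from uniform\<close>

locale far_blocks = blocks I B R t P d for I :: "'v set" and B R t P d +
  fixes n :: nat and \<epsilon> :: real
  assumes n_ge: "2 \<le> n" and t_ge: "1 \<le> t" and t_le: "t \<le> n"
    and eps: "0 < \<epsilon>" "\<epsilon> \<le> 1"
    and P_subset: "set_pmf P \<subseteq> {1..n}" and far: "\<epsilon> \<le> dTV n P (unif n)"
begin

text \<open>G is the gap between the means of the miss rate under U and under P, W bounds its second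
  moment around \<open>q0\<close> under both, and K is the order of magnitude of the expected gap.\<close>

definition "\<delta> x = pmf P x - 1 / real n"
definition "q0 = (1 - 1 / real n) ^ t"
definition "K = (\<Sum>x\<in>{1..n}. \<bar>\<delta> x\<bar> * clip t (\<delta> x))"
definition "G \<omega> = - (\<Sum>x\<in>{1..n}. \<delta> x * Q \<omega> x)"
definition "W \<omega> = (\<Sum>x\<in>{1..n}. (pmf P x + 1 / real n) * (Q \<omega> x - q0)\<^sup>2)"
definition "\<Delta> = (\<Sum>x\<in>{1..n}. \<delta> x * (q0 - q x))"

lemma sum_pmf_P: "(\<Sum>x\<in>{1..n}. pmf P x) = 1"
  using P_subset by (intro sum_pmf_eq_1) auto

lemma sum_\<delta>: "(\<Sum>x\<in>{1..n}. \<delta> x) = 0"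
  using n_ge sum_pmf_P by (simp add: \<delta>_def sum_subtractf)

lemma sum_abs_\<delta>: "2 * \<epsilon> \<le> (\<Sum>x\<in>{1..n}. \<bar>\<delta> x\<bar>)"
proof -
  have "(\<Sum>x\<in>{1..n}. \<bar>pmf P x - pmf (unif n) x\<bar>) = (\<Sum>x\<in>{1..n}. \<bar>\<delta> x\<bar>)"
    using n_ge by (intro sum.cong) (auto simp: \<delta>_def unif_def)
  then show ?thesis using far by (simp add: dTV_def)
qed

lemma K_ge: "real t * \<epsilon>\<^sup>2 / real n \<le> K"
proof -
  have n: "real n > 0" using n_ge by simp
  have a: "0 \<le> real t * \<epsilon> / real n" "real t * \<epsilon> / real n \<le> 1"
    using t_le eps n mult_mono[of "real t" "real n" \<epsilon> 1] by auto
  \<comment> \<open>A lower bound linear in |\<delta>|: nonpositive below \<epsilon>/n, while above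
    it the clip is at least t\<epsilon>/n. In the sum, the subtracted terms cost \<epsilon> in
    total, half of the available 2\<epsilon>.\<close>
  have pt: "real t * \<epsilon> / real n * (\<bar>\<delta> x\<bar> - \<epsilon> / real n) \<le> \<bar>\<delta> x\<bar> * clip t (\<delta> x)" for x
  proof (cases "\<bar>\<delta> x\<bar> \<le> \<epsilon> / real n")
    case True
    then have "real t * \<epsilon> / real n * (\<bar>\<delta> x\<bar> - \<epsilon> / real n) \<le> 0"
      using a by (intro mult_nonneg_nonpos) auto
    also have "0 \<le> \<bar>\<delta> x\<bar> * clip t (\<delta> x)" by (simp add: clip_nonneg)
    finally show ?thesis .
  next
    case False
    then have "real t * (\<epsilon> / real n) \<le> real t * \<bar>\<delta> x\<bar>" by (intro mult_left_mono) auto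
    then have "real t * \<epsilon> / real n \<le> clip t (\<delta> x)" using a by (simp add: clip_def)
    then have "\<bar>\<delta> x\<bar> * (real t * \<epsilon> / real n) \<le> \<bar>\<delta> x\<bar> * clip t (\<delta> x)"
      by (intro mult_left_mono) auto
    moreover have "real t * \<epsilon> / real n * (\<bar>\<delta> x\<bar> - \<epsilon> / real n) \<le> \<bar>\<delta> x\<bar> * (real t * \<epsilon> / real n)"
      using a eps n mult_left_mono[of "\<bar>\<delta> x\<bar> - \<epsilon> / real n" "\<bar>\<delta> x\<bar>" "real t * \<epsilon> / real n"]
      by (simp add: mult.commute)
    ultimately show ?thesis by linarith
  qed
  have "real t * \<epsilon>\<^sup>2 / real n = real t * \<epsilon> / real n * (2 * \<epsilon> - \<epsilon>)"
    by (simp add: power2_eq_square)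
  also have "\<dots> \<le> real t * \<epsilon> / real n * ((\<Sum>x\<in>{1..n}. \<bar>\<delta> x\<bar>) - \<epsilon>)"
    using sum_abs_\<delta> a by (intro mult_left_mono) auto
  also have "\<dots> = (\<Sum>x\<in>{1..n}. real t * \<epsilon> / real n * (\<bar>\<delta> x\<bar> - \<epsilon> / real n))"
    using n by (simp only: sum_distrib_left[symmetric] sum_subtractf) simp
  also have "\<dots> \<le> K" unfolding K_def by (intro sum_mono pt)
  finally show ?thesis .
qed

lemma K_pos: "0 < K"
proof -
  have "0 < real t * \<epsilon>\<^sup>2 / real n" using n_ge t_ge eps by simp
  then show ?thesis using K_ge by linarith
qed

lemma \<Delta>_eq: "\<Delta> = - (\<Sum>x\<in>{1..n}. \<delta> x * q x)"
  using sum_\<delta> by (simp add: \<Delta>_def right_diff_distrib sum_subtractf sum_distrib_right[symmetric])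

text \<open>No cancellation occurs between points: the miss probability decreases in the mass, so
  every summand is nonnegative and can be bounded separately.\<close>

lemma \<Delta>_ge: "K / 12 \<le> \<Delta>"
  unfolding K_def \<Delta>_def sum_divide_distrib
proof (rule sum_mono)
  fix x
  show "\<bar>\<delta> x\<bar> * clip t (\<delta> x) / 12 \<le> \<delta> x * (q0 - q x)"
    using miss_gap_ge[OF n_ge t_le, of "pmf P x"] by (simp add: \<delta>_def q0_def q_def pmf_le_1)
qed

lemma abs_q_diff_le: "\<bar>q x - q0\<bar> \<le> clip t (\<delta> x)"
  using miss_gap_le[of "pmf P x" "1 / real n" t] n_ge
  by (simp add: \<delta>_def q0_def q_def pmf_le_1)

lemma \<Delta>_le: "\<Delta> \<le> K"
  unfolding K_def \<Delta>_def
proof (rule sum_mono)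
  fix x
  have "\<delta> x * (q0 - q x) \<le> \<bar>\<delta> x\<bar> * \<bar>q x - q0\<bar>"
    by (metis abs_ge_self abs_mult abs_minus_commute)
  also have "\<dots> \<le> \<bar>\<delta> x\<bar> * clip t (\<delta> x)" by (intro mult_left_mono abs_q_diff_le) auto
  finally show "\<delta> x * (q0 - q x) \<le> \<bar>\<delta> x\<bar> * clip t (\<delta> x)" .
qed

text \<open>Chebyshev's inequality around \<Delta> \<ge> K/12. The second moment 4K/(tR) gives
  failure probability at most 2304/(tRK), and K \<ge> t\<epsilon>^2/n then asks for 82944 = 36 *
  2304.\<close>

lemma prob_G_small:
  assumes "82944 * real n \<le> real R * (real t)\<^sup>2 * \<epsilon>\<^sup>2"
  shows "measure_pmf.prob M {\<omega>. G \<omega> < K / 24} \<le> 1 / 36"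
proof -
  let ?S = "\<lambda>\<omega>. (\<Sum>x\<in>{1..n}. \<delta> x * (Q \<omega> x - q x))"
  have pos: "0 < real R" "0 < real t" "0 < real n" using R_pos t_ge n_ge by auto
  have G: "G \<omega> = \<Delta> - ?S \<omega>" for \<omega>
    by (simp add: G_def \<Delta>_eq right_diff_distrib sum_subtractf)
  \<comment> \<open>Trading one factor |\<delta>| for a clip makes the variance proportional to K
    itself, so the bound only improves when K exceeds its guaranteed size.\<close>
  have "(\<Sum>x\<in>{1..n}. (\<delta> x)\<^sup>2 * (q x * (1 - q x))) \<le> (\<Sum>x\<in>{1..n}. 2 / real t * (\<bar>\<delta> x\<bar> * clip t (\<delta> x)))"
  proof (rule sum_mono)
    fix x
    have "\<bar>\<delta> x\<bar> / real t * (real t * \<bar>\<delta> x\<bar> * (q x * (1 - q x))) \<le> \<bar>\<delta> x\<bar> / real t * (2 * clip t (\<delta> x))"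
      using miss_variance_le[OF t_le, of "pmf P x"] n_ge
      by (intro mult_left_mono) (auto simp: \<delta>_def q_def pmf_le_1)
    moreover have "\<bar>\<delta> x\<bar> / real t * (real t * \<bar>\<delta> x\<bar> * (q x * (1 - q x))) = (\<delta> x)\<^sup>2 * (q x * (1 - q x))"
      using pos by (simp add: power2_eq_square abs_mult_self_eq mult.assoc[symmetric])
    ultimately show "(\<delta> x)\<^sup>2 * (q x * (1 - q x)) \<le> 2 / real t * (\<bar>\<delta> x\<bar> * clip t (\<delta> x))"
      by (simp add: mult_ac)
  qed
  also have "\<dots> = 2 / real t * K" by (simp add: K_def sum_distrib_left)
  finally have "2 * (\<Sum>x\<in>{1..n}. (\<delta> x)\<^sup>2 * (q x * (1 - q x))) / real R \<le> 2 * (2 / real t * K) / real R"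
    using pos by (intro divide_right_mono mult_left_mono) auto
  then have ES: "measure_pmf.expectation M (\<lambda>\<omega>. (?S \<omega>)\<^sup>2) \<le> 4 * K / (real t * real R)"
    using second_moment_linear[of "{1..n}" \<delta>] by (simp add: field_simps)
  have sub: "{\<omega>. G \<omega> < K / 24} \<subseteq> {\<omega>. (K / 24)\<^sup>2 \<le> (?S \<omega>)\<^sup>2}"
  proof clarify
    fix \<omega> assume "G \<omega> < K / 24"
    then have "K / 24 \<le> ?S \<omega>" using \<Delta>_ge unfolding G by linarith
    then show "(K / 24)\<^sup>2 \<le> (?S \<omega>)\<^sup>2" using K_pos by (intro power_mono) auto
  qed
  have "measure_pmf.prob M {\<omega>. G \<omega> < K / 24} \<le> measure_pmf.prob M {\<omega>. (K / 24)\<^sup>2 \<le> (?S \<omega>)\<^sup>2}"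
    using sub by (intro measure_pmf.finite_measure_mono) auto
  also have "\<dots> \<le> measure_pmf.expectation M (\<lambda>\<omega>. (?S \<omega>)\<^sup>2) / (K / 24)\<^sup>2"
    using K_pos finite_I finite_P by (intro markov_pmf finite_set_Pi_pmf) auto
  also have "\<dots> \<le> 4 * K / (real t * real R) / (K / 24)\<^sup>2"
    by (intro divide_right_mono ES) auto
  also have "\<dots> = 2304 / (real t * real R * K)"
    using K_pos by (simp add: field_simps power2_eq_square)
  also have "\<dots> \<le> 2304 / (real t * real R * (real t * \<epsilon>\<^sup>2 / real n))"
    using pos K_ge K_pos eps by (intro divide_left_mono mult_left_mono mult_pos_pos) auto
  also have "\<dots> = 2304 * real n / (real R * (real t)\<^sup>2 * \<epsilon>\<^sup>2)"
    using pos eps by (simp add: field_simps power2_eq_square)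
  also have "\<dots> \<le> 1 / 36"
    using assms pos eps by (simp add: field_simps)
  finally show ?thesis .
qed

lemma expectation_W_le: "measure_pmf.expectation M W \<le> 4 * K + 2 * real t / (real n * real R)"
proof -
  have pos: "0 < real R" "0 < real t" "0 < real n" using R_pos t_ge n_ge by auto
  \<comment> \<open>Variance plus squared bias. Of q (1 - q) only 1 - q is kept, which is small for
    rare points.\<close>
  have sq: "measure_pmf.expectation M (\<lambda>\<omega>. (Q \<omega> x - q0)\<^sup>2) \<le> (1 - q x) / real R + (clip t (\<delta> x))\<^sup>2" for x
  proof -
    have "measure_pmf.expectation M (\<lambda>\<omega>. (Q \<omega> x - q0)\<^sup>2)
        = measure_pmf.expectation M (\<lambda>\<omega>. (Q \<omega> x - q x) * (Q \<omega> x - q x) + 2 * (q x - q0) * Q \<omega> x + (q0\<^sup>2 - (q x)\<^sup>2))"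
      by (intro Bochner_Integration.integral_cong) (auto simp: power2_eq_square algebra_simps)
    also have "\<dots> = measure_pmf.expectation M (\<lambda>\<omega>. (Q \<omega> x - q x) * (Q \<omega> x - q x))
        + 2 * (q x - q0) * q x + (q0\<^sup>2 - (q x)\<^sup>2)"
      by (simp add: expectation_miss_rate)
    also have "\<dots> = measure_pmf.expectation M (\<lambda>\<omega>. (Q \<omega> x - q x) * (Q \<omega> x - q x)) + (q x - q0)\<^sup>2"
      by (simp add: power2_eq_square algebra_simps)
    also have "\<dots> \<le> q x * (1 - q x) / real R + (clip t (\<delta> x))\<^sup>2"
      using covariance_miss_rate[of x x] abs_q_diff_le[of x] clip_nonneg[of t "\<delta> x"]
      by (intro add_mono) (auto simp: abs_le_square_iff[symmetric])
    also have "\<dots> \<le> (1 - q x) / real R + (clip t (\<delta> x))\<^sup>2"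
      using q_bounds[of x] pos mult_right_mono[of "q x" 1 "1 - q x"]
      by (intro add_mono divide_right_mono) auto
    finally show ?thesis .
  qed
  have "measure_pmf.expectation M W
      = (\<Sum>x\<in>{1..n}. (pmf P x + 1 / real n) * measure_pmf.expectation M (\<lambda>\<omega>. (Q \<omega> x - q0)\<^sup>2))"
    unfolding W_def[abs_def] by simp
  also have "\<dots> \<le> (\<Sum>x\<in>{1..n}. (pmf P x + 1 / real n) * ((1 - q x) / real R + (clip t (\<delta> x))\<^sup>2))"
    by (intro sum_mono mult_left_mono sq) auto
  also have "\<dots> \<le> (\<Sum>x\<in>{1..n}. 2 * real t / (real n * real R) * pmf P x + \<delta> x * (1 - q x) / real R
      + 3 * (\<bar>\<delta> x\<bar> * clip t (\<delta> x)))"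
  proof (rule sum_mono)
    fix x
    \<comment> \<open>Splitting the weight as 2/n + \<delta> handles the variance: the first part is
      summable by 1 - q \<le> tp, and the second adds up to \<Delta>/R \<le> K because \<delta> sums
      to 0.\<close>
    have w: "pmf P x + 1 / real n = 2 / real n + \<delta> x" by (simp add: \<delta>_def)
    have "1 - q x \<le> real t * pmf P x"
      using Bernoulli_inequality[of "- pmf P x" t] pmf_le_1[of P x] by (simp add: q_def)
    then have "2 / real n * ((1 - q x) / real R) \<le> 2 / real n * (real t * pmf P x / real R)"
      using pos by (intro mult_left_mono divide_right_mono) auto
    then have 1: "(pmf P x + 1 / real n) * ((1 - q x) / real R)
        \<le> 2 * real t / (real n * real R) * pmf P x + \<delta> x * (1 - q x) / real R"
      unfolding w by (simp add: algebra_simps)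
    define c where "c = clip t (\<delta> x)"
    have c: "0 \<le> c" "c \<le> 1" "c \<le> real n * \<bar>\<delta> x\<bar>"
      using clip_nonneg[of t "\<delta> x"] clip_le[of t "\<delta> x"] mult_right_mono[of "real t" "real n" "\<bar>\<delta> x\<bar>"] t_le
      by (auto simp: c_def)
    have "c\<^sup>2 / real n \<le> \<bar>\<delta> x\<bar> * c"
      using pos c mult_right_mono[OF c(3), of c] by (simp add: power2_eq_square field_simps)
    moreover have "\<delta> x * c\<^sup>2 \<le> \<bar>\<delta> x\<bar> * c"
      using c mult_left_mono[of c 1 c] by (intro mult_mono) (auto simp: power2_eq_square)
    ultimately have 2: "(pmf P x + 1 / real n) * c\<^sup>2 \<le> 3 * (\<bar>\<delta> x\<bar> * c)"
      unfolding w by (simp add: distrib_right)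
    show "(pmf P x + 1 / real n) * ((1 - q x) / real R + (clip t (\<delta> x))\<^sup>2)
      \<le> 2 * real t / (real n * real R) * pmf P x + \<delta> x * (1 - q x) / real R
        + 3 * (\<bar>\<delta> x\<bar> * clip t (\<delta> x))"
      using 1 2 unfolding c_def by (simp only: distrib_left[of "pmf P x + 1 / real n"])
  qed
  also have "\<dots> = 2 * real t / (real n * real R) * (\<Sum>x\<in>{1..n}. pmf P x)
      + (\<Sum>x\<in>{1..n}. \<delta> x * (1 - q x)) / real R + 3 * K"
    by (simp only: sum.distrib K_def sum_distrib_left sum_divide_distrib)
  also have "(\<Sum>x\<in>{1..n}. \<delta> x * (1 - q x)) = \<Delta>"
    using sum_\<delta> by (simp add: \<Delta>_eq right_diff_distrib sum_subtractf)
  also have "2 * real t / (real n * real R) * (\<Sum>x\<in>{1..n}. pmf P x) + \<Delta> / real R + 3 * K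
      \<le> 2 * real t / (real n * real R) + K / 1 + 3 * K"
    using \<Delta>_le \<Delta>_ge K_pos R_pos unfolding sum_pmf_P by (intro add_mono frac_le) auto
  finally show ?thesis by simp
qed

text \<open>Chebyshev for \<open>G\<close> and Markov for \<open>W\<close> each fail with
  probability at most 1/36; 144 is 36 times the 4 in the bound on the mean of
  \<open>W\<close>.\<close>

lemma prob_training:
  assumes "82944 * real n \<le> real R * (real t)\<^sup>2 * \<epsilon>\<^sup>2"
  shows "measure_pmf.prob M {\<omega>. G \<omega> < K / 24 \<or> 144 * (K + real t / (real n * real R)) \<le> W \<omega>} \<le> 1 / 18"
proof -
  let ?c = "144 * (K + real t / (real n * real R))"
  have c: "0 < ?c" "36 * (4 * K + 2 * real t / (real n * real R)) \<le> ?c"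
  proof -
    define y where "y = real t / (real n * real R)"
    have "2 * real t / (real n * real R) = 2 * y" "0 \<le> y" by (auto simp: y_def)
    then show "0 < ?c" "36 * (4 * K + 2 * real t / (real n * real R)) \<le> ?c"
      using K_pos by (auto simp: y_def[symmetric])
  qed
  have "measure_pmf.prob M {\<omega>. ?c \<le> W \<omega>} \<le> measure_pmf.expectation M W / ?c"
    using c finite_I finite_P
    by (intro markov_pmf finite_set_Pi_pmf) (auto simp: W_def intro!: sum_nonneg)
  also have "\<dots> \<le> 1 / 36"
    using c expectation_W_le by (simp add: field_simps)
  finally have "measure_pmf.prob M {\<omega>. ?c \<le> W \<omega>} \<le> 1 / 36" .
  moreover have "measure_pmf.prob M ({\<omega>. G \<omega> < K / 24} \<union> {\<omega>. ?c \<le> W \<omega>})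
      \<le> measure_pmf.prob M {\<omega>. G \<omega> < K / 24} + measure_pmf.prob M {\<omega>. ?c \<le> W \<omega>}"
    by (rule measure_Un_le) auto
  moreover have "{\<omega>. G \<omega> < K / 24} \<union> {\<omega>. ?c \<le> W \<omega>} = {\<omega>. G \<omega> < K / 24 \<or> ?c \<le> W \<omega>}" by auto
  ultimately show ?thesis using prob_G_small[OF assms] by simp
qed

text \<open>The exponent of the tail bound for deviation G'/4 and variance proxy W' + G'; adding G'
  secures its range condition h \<le> 2V. With L = ln k the value 8L yields failure probability of
  order k^-8.\<close>

lemma exponent_ge:
  assumes good: "K / 24 \<le> G'" "0 \<le> W'" "W' \<le> 144 * (K + real t / (real n * real R))"
    and L: "0 \<le> L"
    and m: "10^8 * L * (real n / (real t * \<epsilon>\<^sup>2) + real n / (real t * real R * \<epsilon>^4)) \<le> m"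
  shows "8 * L \<le> m * (G' / 4)\<^sup>2 / (4 * (W' + G'))"
proof -
  have pos: "0 < real R" "0 < real t" "0 < real n" using R_pos t_ge n_ge by auto
  define a where "a = real t / real n"
  have a: "0 < a" using pos by (simp add: a_def)
  have Ka: "a * \<epsilon>\<^sup>2 \<le> K" using K_ge by (simp add: a_def)
  have ae: "0 < a * \<epsilon>\<^sup>2" using a eps by simp
  have m': "10^8 * L * (1 / (a * \<epsilon>\<^sup>2) + 1 / (a * real R * \<epsilon>^4)) \<le> m"
    using m pos by (simp add: a_def)
  have m0: "0 \<le> m"
    using m' L a pos eps by (intro order_trans[OF _ m'] mult_nonneg_nonneg add_nonneg_nonneg) auto
  \<comment> \<open>The bound K \<ge> a\<epsilon>^2 turns the condition on m into one on K: mK^2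
    dominates L (K + a/R), which pays for W', and mK dominates L, which pays for G'.\<close>
  have "1 \<le> K / (a * \<epsilon>\<^sup>2)" using Ka ae by (simp add: field_simps)
  then have A: "1 * K \<le> K / (a * \<epsilon>\<^sup>2) * K" using K_pos by (intro mult_right_mono) auto
  have "a / real R = (a * \<epsilon>\<^sup>2)\<^sup>2 / (a * real R * \<epsilon>^4)"
    using a pos eps by (simp add: field_simps power2_eq_square power4_eq_xxxx)
  also have "\<dots> \<le> K\<^sup>2 / (a * real R * \<epsilon>^4)"
    using Ka ae a pos eps by (intro divide_right_mono power_mono) auto
  finally have Bb: "a / real R \<le> K\<^sup>2 / (a * real R * \<epsilon>^4)" .
  have "10^8 * L * (K + a / real R) \<le> 10^8 * L * (K / (a * \<epsilon>\<^sup>2) * K + K\<^sup>2 / (a * real R * \<epsilon>^4))"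
    using A Bb L by (intro mult_left_mono) auto
  also have "\<dots> = 10^8 * L * (1 / (a * \<epsilon>\<^sup>2) + 1 / (a * real R * \<epsilon>^4)) * K\<^sup>2"
    by (simp add: algebra_simps power2_eq_square)
  also have "\<dots> \<le> m * K\<^sup>2" using m' by (intro mult_right_mono) auto
  finally have mK2: "10^8 * L * (K + a / real R) \<le> m * K\<^sup>2" .
  have "10^8 * L * K \<le> 10^8 * L * (K + a / real R)"
    using L a pos by (intro mult_left_mono) auto
  then have "10^8 * L * K \<le> m * K * K" using mK2 by (simp add: power2_eq_square)
  then have mK: "10^8 * L \<le> m * K" using K_pos by simp
  have G0: "0 < G'" using good K_pos by linarith
  have "(K / 24)\<^sup>2 \<le> G'\<^sup>2" using good K_pos by (intro power_mono) auto
  then have "m * (K / 24)\<^sup>2 \<le> m * G'\<^sup>2" using m0 by (rule mult_left_mono)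
  then have g1: "m * K\<^sup>2 \<le> 576 * (m * G'\<^sup>2)" by (simp add: power_divide)
  \<comment> \<open>G' may far exceed K, so one factor G' is kept and only the other is compared
    with K.\<close>
  have "m * (K / 24) * G' \<le> m * G' * G'"
    using good m0 G0 by (intro mult_right_mono mult_left_mono) auto
  moreover have "10^8 * L * G' \<le> m * K * G'" using mK G0 by (intro mult_right_mono) auto
  ultimately have g2: "10^8 * (L * G') \<le> 24 * (m * G'\<^sup>2)"
    by (simp add: power2_eq_square algebra_simps)
  have "L * W' \<le> L * (144 * (K + a / real R))"
    using good(3) L by (intro mult_left_mono) (auto simp: a_def)
  then have g3: "10^8 * (L * W') \<le> 144 * (m * K\<^sup>2)" using mK2 by (simp add: algebra_simps)
  \<comment> \<open>Here 512 = 8 * 64, and 64 = 16 * 4 collects the denominators of the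
    exponent.\<close>
  have "512 * (L * W' + L * G') \<le> m * G'\<^sup>2"
    using g1 g2 g3 mult_nonneg_nonneg[OF m0 zero_le_power2[of G']]
    by (simp add: mult.commute[of G' L])
  then have "8 * L * (64 * (W' + G')) \<le> m * G'\<^sup>2" by (simp add: algebra_simps)
  then show ?thesis using G0 good(2) by (simp add: field_simps power2_eq_square)
qed

end

section \<open>The classifier\<close>

text \<open>A sample is tagged (source, block, position). Blocks 1, ..., R of source 0 are the training
  blocks; block 0 of each source (including source 0, that is P) is used for evaluation.\<close>

definition train_block :: "nat \<Rightarrow> nat \<Rightarrow> (nat \<times> nat \<times> nat) set" where
  "train_block t r = {0} \<times> {r} \<times> {..<t}"

definition eval_block :: "nat \<Rightarrow> nat \<Rightarrow> (nat \<times> nat \<times> nat) set" where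
  "eval_block m i = {i} \<times> {0} \<times> {..<m}"

definition train_tags :: "nat \<Rightarrow> nat \<Rightarrow> (nat \<times> nat \<times> nat) set" where
  "train_tags R t = {0} \<times> {1..R} \<times> {..<t}"

definition eval_tags :: "nat \<Rightarrow> nat \<Rightarrow> (nat \<times> nat \<times> nat) set" where
  "eval_tags k m = {..k} \<times> {0} \<times> {..<m}"

definition uniform_mean :: "nat \<Rightarrow> (nat \<Rightarrow> real) \<Rightarrow> real" where
  "uniform_mean n f = (\<Sum>x\<in>{1..n}. f x) / real n"

definition sample_mean :: "nat \<Rightarrow> (nat \<Rightarrow> real) \<Rightarrow> (nat \<times> nat \<times> nat \<Rightarrow> nat) \<Rightarrow> nat \<Rightarrow> real" where
  "sample_mean m f \<omega> i = (\<Sum>v\<in>eval_block m i. f (\<omega> v)) / real m"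

text \<open>The threshold is half the gap observed on fresh samples of P, since the true gap is
  unknown and may be much larger than its guaranteed lower bound.\<close>

definition guess :: "nat \<Rightarrow> nat \<Rightarrow> nat \<Rightarrow> nat \<Rightarrow> (nat \<times> nat \<times> nat \<Rightarrow> nat) \<Rightarrow> nat \<Rightarrow> bool" where
  "guess n R t m \<omega> i = (let f = miss_rate (train_block t) R \<omega>; u = uniform_mean n f in
     (u - sample_mean m f \<omega> 0) / 2 < u - sample_mean m f \<omega> i)"

lemma miss_rate_cong:
  assumes "\<And>r v. r \<in> {1..R} \<Longrightarrow> v \<in> B r \<Longrightarrow> \<omega> v = \<omega>' v"
  shows "miss_rate B R \<omega> = miss_rate B R \<omega>'"
  using assms unfolding miss_rate_def fun_eq_iff
  by (intro allI arg_cong2[where f="(/)"] sum.cong prod.cong) auto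

text \<open>With all deviations below g/4, the threshold lies between 3g/8 and 5g/8, while the
  observed gap of a source is below g/4 under U and above 3g/4 under P.\<close>

lemma guess_correct:
  fixes \<omega> :: "nat \<times> nat \<times> nat \<Rightarrow> nat" and t R :: nat
  defines "f \<equiv> miss_rate (train_block t) R \<omega>"
  assumes dev: "\<And>i. i \<le> k \<Longrightarrow> \<bar>sample_mean m f \<omega> i - E i\<bar> < g / 4"
    and E: "E 0 = uniform_mean n f - g" "i \<le> k" "E i = uniform_mean n f - (if c then g else 0)"
  shows "guess n R t m \<omega> i = c"
  using dev[of 0] dev[OF E(2)] E(1,3)
  unfolding guess_def Let_def f_def[symmetric]
  by (cases c; simp add: abs_less_iff; linarith)

lemma expectation_unif:
  fixes f :: "nat \<Rightarrow> real"
  assumes "1 \<le> n"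
  shows "measure_pmf.expectation (unif n) f = (\<Sum>x\<in>{1..n}. f x) / real n"
  using assms unfolding unif_def by (subst integral_pmf_of_set) auto

text \<open>Absorbs the union bound: k + 1 sources, each failing with probability at most 2/k^8,
  contribute at most 1/18.\<close>

lemma power8_ge:
  assumes "2 \<le> k"
  shows "36 * (real k + 1) \<le> real k ^ 8"
proof -
  have k: "2 \<le> real k" using assms by simp
  have "2 ^ 6 * (real k * 2) \<le> real k ^ 6 * (real k * real k)"
    using k by (intro mult_mono power_mono) auto
  moreover have "real k ^ 6 * (real k * real k) = real k ^ 8"
    by (simp add: power_add[symmetric] power2_eq_square[symmetric])
  ultimately show ?thesis using k by simp
qed

lemma far_imp_two_le:
  assumes "1 \<le> n" "0 < \<epsilon>" "set_pmf P \<subseteq> {1..n}" "\<epsilon> \<le> dTV n P (unif n)"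
  shows "2 \<le> n"
proof (rule ccontr)
  assume "\<not> 2 \<le> n"
  then have n: "n = 1" using assms by simp
  have "pmf P 1 = 1" using sum_pmf_eq_1[of "{1..n}" P] assms by (simp add: n)
  then have "dTV n P (unif n) = 0" by (simp add: dTV_def n unif_def)
  then show False using assms by simp
qed

text \<open>The budget 1/9 is split evenly: 1/18 for bad training data, and 1/18 for evaluation
  given good training data.\<close>

lemma prob_guess_wrong:
  assumes n: "1 \<le> n" and k: "2 \<le> k" and eps: "0 < \<epsilon>" "\<epsilon> \<le> 1"
    and P: "set_pmf P \<subseteq> {1..n}" "\<epsilon> \<le> dTV n P (unif n)"
    and t: "1 \<le> t" "t \<le> n" and R: "1 \<le> R" and m: "1 \<le> m"
    and train: "82944 * real n \<le> real R * (real t)\<^sup>2 * \<epsilon>\<^sup>2"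
    and eval: "10^8 * ln (real k) * (real n / (real t * \<epsilon>\<^sup>2) + real n / (real t * real R * \<epsilon>^4)) \<le> real m"
  shows "measure_pmf.prob (Pi_pmf (train_tags R t \<union> eval_tags k m) 0 (\<lambda>v. sources n k P b (fst v)))
    {\<omega>. \<exists>i\<in>{1..k}. guess n R t m \<omega> i \<noteq> b i} \<le> 1 / 9"
proof -
  let ?I0 = "train_tags R t" and ?I1 = "eval_tags k m"
  let ?src = "\<lambda>v :: nat \<times> nat \<times> nat. sources n k P b (fst v)"
  let ?bad = "{\<omega>. \<exists>i\<in>{1..k}. guess n R t m \<omega> i \<noteq> b i}"
  have finP: "finite (set_pmf P)" using P finite_subset by blast
  interpret far_blocks ?I0 "train_block t" R t P 0 n \<epsilon>
  proof
    show "2 \<le> n" using far_imp_two_le[OF n eps(1) P] .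
    show "card (train_block t r) = t" for r by (simp add: train_block_def card_cartesian_product)
  qed (use finP R t eps P in \<open>auto simp: train_tags_def train_block_def\<close>)
  have fin: "finite ?I0" "finite ?I1" "?I0 \<inter> ?I1 = {}"
    by (auto simp: train_tags_def eval_tags_def)
  have srcP: "sources n k P b 0 = P" by (simp add: sources_def)
  have fin_src: "finite (set_pmf (sources n k P b i))" for i
    using finP n by (auto simp: sources_def unif_def)
  have src0: "Pi_pmf ?I0 0 ?src = M"
    by (intro Pi_pmf_cong) (auto simp: train_tags_def srcP)
  let ?comb = "\<lambda>\<omega>0 \<omega>1 v. if v \<in> ?I0 then \<omega>0 v else \<omega>1 v :: nat"
  \<comment> \<open>Training and evaluation tags are disjoint, so the product can be drawn in two
    rounds, and the miss rate is a fixed function during the second.\<close>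
  have split: "Pi_pmf (?I0 \<union> ?I1) 0 ?src = bind_pmf M (\<lambda>\<omega>0. map_pmf (?comb \<omega>0) (Pi_pmf ?I1 0 ?src))"
    unfolding Pi_pmf_union[OF fin] src0
    by (simp add: pair_pmf_def map_bind_pmf map_pmf_def bind_assoc_pmf bind_return_pmf)
  let ?badtrain = "{\<omega>. G \<omega> < K / 24 \<or> 144 * (K + real t / (real n * real R)) \<le> W \<omega>}"
  have cond: "measure_pmf.prob (map_pmf (?comb \<omega>0) (Pi_pmf ?I1 0 ?src)) ?bad \<le> 1 / 18"
    if good: "\<omega>0 \<notin> ?badtrain" for \<omega>0
  proof -
    define f where "f = Q \<omega>0"
    define E where "E i = measure_pmf.expectation (sources n k P b i) f" for i
    define g where "g = G \<omega>0"
    have f01: "0 \<le> f x" "f x \<le> 1" for x by (auto simp: f_def miss_rate_bounds)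
    have g: "0 < g" "K / 24 \<le> g" using good K_pos by (auto simp: g_def)
    have W0: "0 \<le> W \<omega>0" by (auto simp: W_def intro!: sum_nonneg)
    have fmeans: "measure_pmf.expectation P h = (\<Sum>x\<in>{1..n}. pmf P x * h x)" for h :: "nat \<Rightarrow> real"
      using P(1) by (subst integral_measure_pmf_real[of "{1..n}"]) (auto simp: mult.commute)
    have EP: "measure_pmf.expectation P f = uniform_mean n f - g"
      unfolding fmeans g_def G_def \<delta>_def uniform_mean_def f_def
      by (simp add: left_diff_distrib sum_subtractf sum_divide_distrib)
    have EU: "measure_pmf.expectation (unif n) f = uniform_mean n f"
      using n by (simp add: expectation_unif uniform_mean_def)
    have Ei: "E 0 = uniform_mean n f - g"
      "i \<in> {1..k} \<Longrightarrow> E i = uniform_mean n f - (if b i then g else 0)" for i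
      by (auto simp: E_def sources_def EP EU)
    \<comment> \<open>The weight p + 1/n in \<open>W\<close> dominates both distributions, so one
      variance bound serves every source.\<close>
    have var: "measure_pmf.expectation (sources n k P b i) (\<lambda>x. (f x - q0)\<^sup>2) \<le> W \<omega>0 + g" for i
    proof -
      have "measure_pmf.expectation P (\<lambda>x. (f x - q0)\<^sup>2) \<le> W \<omega>0"
        unfolding fmeans W_def f_def by (intro sum_mono mult_right_mono) auto
      moreover have "measure_pmf.expectation (unif n) (\<lambda>x. (f x - q0)\<^sup>2) \<le> W \<omega>0"
        unfolding expectation_unif[OF n] sum_divide_distrib W_def f_def
      proof (intro sum_mono)
        fix x
        have "1 / real n * (Q \<omega>0 x - q0)\<^sup>2 \<le> (pmf P x + 1 / real n) * (Q \<omega>0 x - q0)\<^sup>2"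
          by (intro mult_right_mono) auto
        then show "(Q \<omega>0 x - q0)\<^sup>2 / real n \<le> (pmf P x + 1 / real n) * (Q \<omega>0 x - q0)\<^sup>2" by simp
      qed
      ultimately show ?thesis using g by (auto simp: sources_def)
    qed
    let ?D = "\<lambda>i. {\<omega>1. g / 4 \<le> \<bar>sample_mean m f \<omega>1 i - E i\<bar>}"
    have dev: "measure_pmf.prob (Pi_pmf ?I1 0 ?src) (?D i) \<le> 2 / real k ^ 8" if i: "i \<in> {..k}" for i
    proof -
      have card: "card (eval_block m i) = m" by (simp add: eval_block_def card_cartesian_product)
      have "measure_pmf.prob (Pi_pmf ?I1 0 ?src) {\<omega>1. g / 4 \<le>
            \<bar>(\<Sum>v\<in>eval_block m i. f (\<omega>1 v)) / real (card (eval_block m i))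
              - measure_pmf.expectation (sources n k P b i) f\<bar>}
          \<le> 2 * exp (- (real (card (eval_block m i)) * (g / 4)\<^sup>2 / (4 * (W \<omega>0 + g))))"
      proof (rule prob_iid_mean_deviation[where c = q0])
        show "eval_block m i \<subseteq> ?I1" using i by (auto simp: eval_block_def eval_tags_def)
        show "eval_block m i \<noteq> {}" using m by (auto simp: eval_block_def lessThan_empty_iff)
        show "sources n k P b (fst v) = sources n k P b i" if "v \<in> eval_block m i" for v
          using that by (auto simp: eval_block_def)
      qed (use fin fin_src f01 var g W0 in auto)
      also have "\<dots> \<le> 2 * exp (- (8 * ln (real k)))"
        using exponent_ge[OF g(2) W0 _ _ eval] good k by (simp add: card)
      also have "exp (- (8 * ln (real k))) = 1 / real k ^ 8"
        using k exp_of_nat_mult[of 8 "ln (real k)"] by (simp add: exp_minus field_simps)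
      finally show ?thesis by (simp add: sample_mean_def E_def card)
    qed
    have "?comb \<omega>0 -` ?bad \<subseteq> (\<Union>i\<in>{..k}. ?D i)"
    proof (rule subsetI, rule ccontr)
      fix \<omega>1 assume bad: "\<omega>1 \<in> ?comb \<omega>0 -` ?bad" and no: "\<omega>1 \<notin> (\<Union>i\<in>{..k}. ?D i)"
      let ?\<omega> = "?comb \<omega>0 \<omega>1"
      \<comment> \<open>On the merged sample the miss rate reads only training tags and the sample
        means only evaluation tags, since training blocks are numbered from 1.\<close>
      have Qc: "miss_rate (train_block t) R ?\<omega> = f"
        unfolding f_def by (rule miss_rate_cong) (auto simp: train_block_def train_tags_def)
      have mc: "sample_mean m f ?\<omega> i = sample_mean m f \<omega>1 i" for i
        unfolding sample_mean_def
        by (intro arg_cong2[where f="(/)"] sum.cong) (auto simp: eval_block_def train_tags_def)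
      have "guess n R t m ?\<omega> i = b i" if i: "i \<in> {1..k}" for i
      proof (rule guess_correct[where E = E and g = g and k = k], unfold Qc mc)
        show "\<bar>sample_mean m f \<omega>1 j - E j\<bar> < g / 4" if "j \<le> k" for j
          using no that by (auto simp: not_le)
      qed (use i Ei in auto)
      then show False using bad by auto
    qed
    then have "measure_pmf.prob (Pi_pmf ?I1 0 ?src) (?comb \<omega>0 -` ?bad)
        \<le> measure_pmf.prob (Pi_pmf ?I1 0 ?src) (\<Union>i\<in>{..k}. ?D i)"
      by (intro measure_pmf.finite_measure_mono) auto
    also have "\<dots> \<le> (\<Sum>i\<in>{..k}. measure_pmf.prob (Pi_pmf ?I1 0 ?src) (?D i))"
      by (rule measure_UNION_le) auto
    also have "\<dots> \<le> (\<Sum>i\<in>{..k}. 2 / real k ^ 8)" by (intro sum_mono dev)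
    also have "\<dots> \<le> 1 / 18"
      using power8_ge[OF k] k by (simp add: field_simps)
    finally show ?thesis by simp
  qed
  have "measure_pmf.prob (Pi_pmf (?I0 \<union> ?I1) 0 ?src) ?bad
      \<le> measure_pmf.prob M ?badtrain + 1 / 18"
    unfolding split by (rule prob_bind_le) (use cond in auto)
  also have "\<dots> \<le> 1 / 18 + 1 / 18" using prob_training[OF train] by simp
  finally show ?thesis by simp
qed

section \<open>Choice of parameters\<close>

text \<open>The maximum unifies both regimes of the sample bound: for k \<ge> 2 the square root
  attains it exactly when n \<ge> k ln k.\<close>

definition hardness :: "nat \<Rightarrow> nat \<Rightarrow> real" where
  "hardness n k = max (sqrt (real n * (real k * ln (real k)))) (real k * ln (real k))"

text \<open>A training budget N = hardness/\<epsilon>^2 gives blocks of length about N if N \<le> n;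
  otherwise the length is n and the number of blocks grows like N/n.\<close>

definition block_len :: "nat \<Rightarrow> nat \<Rightarrow> real \<Rightarrow> nat" where
  "block_len n k \<epsilon> = min n (nat \<lceil>hardness n k / \<epsilon>\<^sup>2\<rceil>)"

text \<open>The factor 82944 is the one that \<open>prob_training\<close> demands.\<close>

definition block_count :: "nat \<Rightarrow> nat \<Rightarrow> real \<Rightarrow> nat" where
  "block_count n k \<epsilon> = 82944 * nat \<lceil>hardness n k / \<epsilon>\<^sup>2 / real n\<rceil>"

text \<open>The demand of \<open>exponent_ge\<close> with L = ln k, rounded up.\<close>

definition eval_len :: "nat \<Rightarrow> nat \<Rightarrow> real \<Rightarrow> nat" where
  "eval_len n k \<epsilon> = (let t = real (block_len n k \<epsilon>); R = real (block_count n k \<epsilon>) in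
     nat \<lceil>10^8 * ln (real k) * (real n / (t * \<epsilon>\<^sup>2) + real n / (t * R * \<epsilon>^4))\<rceil>)"

lemma nat_ceiling_bounds:
  assumes "0 < (x::real)"
  shows "1 \<le> nat \<lceil>x\<rceil>" "x \<le> real (nat \<lceil>x\<rceil>)" "real (nat \<lceil>x\<rceil>) \<le> x + 1"
  using assms by (auto simp: of_nat_nat le_nat_iff)

lemma parameters:
  fixes \<epsilon> :: real
  assumes n: "1 \<le> n" and k: "2 \<le> k" and eps: "0 < \<epsilon>" "\<epsilon> \<le> 1"
  defines "t \<equiv> block_len n k \<epsilon>" and "R \<equiv> block_count n k \<epsilon>" and "m \<equiv> eval_len n k \<epsilon>"
  shows "1 \<le> t" "t \<le> n" "1 \<le> R" "1 \<le> m"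
    "82944 * real n \<le> real R * (real t)\<^sup>2 * \<epsilon>\<^sup>2"
    "10^8 * ln (real k) * (real n / (real t * \<epsilon>\<^sup>2) + real n / (real t * real R * \<epsilon>^4)) \<le> real m"
    "real R * real t + (real k + 1) * real m \<le> 10^9 * hardness n k / \<epsilon>\<^sup>2"
proof -
  define \<Lambda> where "\<Lambda> = real k * ln (real k)"
  define H where "H = hardness n k"
  define N where "N = H / \<epsilon>\<^sup>2"
  have lnk: "1 / 2 \<le> ln (real k)"
  proof -
    have "ln 2 \<le> ln (real k)" using k by simp
    then show ?thesis using ln2_ge_two_thirds by linarith
  qed
  have \<Lambda>: "1 \<le> \<Lambda>" using mult_mono[of 2 "real k" "1/2" "ln (real k)"] lnk k by (simp add: \<Lambda>_def)
  have H: "\<Lambda> \<le> H" "sqrt (real n * \<Lambda>) \<le> H" by (auto simp: H_def \<Lambda>_def hardness_def)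
  have H1: "1 \<le> H" using H \<Lambda> by linarith
  have H2: "real n * \<Lambda> \<le> H\<^sup>2"
    using power_mono[OF H(2), of 2] n \<Lambda> by simp
  have e2: "0 < \<epsilon>\<^sup>2" "\<epsilon>\<^sup>2 \<le> 1" using eps by (auto intro: power_le_one)
  have N1: "H \<le> N" using e2 H1 by (simp add: N_def field_simps)
  have N: "1 \<le> N" using N1 H1 by simp
  have npos: "0 < real n" using n by simp
  have t_def': "t = min n (nat \<lceil>N\<rceil>)" and R_def': "R = 82944 * nat \<lceil>N / real n\<rceil>"
    by (auto simp: t_def R_def block_len_def block_count_def N_def H_def)
  have cN: "1 \<le> nat \<lceil>N\<rceil>" "N \<le> real (nat \<lceil>N\<rceil>)" "real (nat \<lceil>N\<rceil>) \<le> N + 1"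
    using nat_ceiling_bounds[of N] N by auto
  have cM: "1 \<le> nat \<lceil>N / real n\<rceil>" "N / real n \<le> real (nat \<lceil>N / real n\<rceil>)"
    "real (nat \<lceil>N / real n\<rceil>) \<le> N / real n + 1"
    using nat_ceiling_bounds[of "N / real n"] N npos by auto
  show t1: "1 \<le> t" and tn: "t \<le> n" and R1: "1 \<le> R"
    using n cN cM by (auto simp: t_def' R_def')
  have pos: "0 < real t" "0 < real R" using t1 R1 by auto
  have Rbig: "82944 \<le> real R" "82944 * N / real n \<le> real R" "real R \<le> 82944 * (N / real n + 1)"
  proof -
    define c y where "c = nat \<lceil>y\<rceil>" and "y = N / real n"
    have "real R = 82944 * real c" by (simp only: R_def' c_def y_def of_nat_mult of_nat_numeral)
    moreover have "1 \<le> real c" "y \<le> real c" "real c \<le> y + 1"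
      using cM unfolding y_def[symmetric] c_def[symmetric] by auto
    moreover have "82944 * N / real n = 82944 * y" by (simp add: y_def)
    ultimately show "82944 \<le> real R" "82944 * N / real n \<le> real R" "real R \<le> 82944 * (N / real n + 1)"
      unfolding y_def[symmetric] by auto
  qed
  \<comment> \<open>Full-length blocks when the budget exceeds n; otherwise length N up to rounding,
    with a constant number of blocks.\<close>
  have tcase: "(t = n \<and> real n \<le> N) \<or> (N \<le> real t \<and> N \<le> real n \<and> real t \<le> N + 1)"
  proof (cases "real n \<le> N")
    case True
    then have "n \<le> nat \<lceil>N\<rceil>" using cN(2) by linarith
    then show ?thesis using True by (simp add: t_def')
  next
    case False
    then show ?thesis using cN by (auto simp: t_def' min_def)
  qed
  have Rt: "82944 * N \<le> real R * real t" "real R * real t \<le> 165888 * N"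
  proof -
    show "82944 * N \<le> real R * real t"
    proof (cases "t = n")
      case True
      then show ?thesis using Rbig(2) npos by (simp add: field_simps)
    next
      case False
      then show ?thesis using tcase Rbig(1) N by (intro mult_mono) auto
    qed
    show "real R * real t \<le> 165888 * N"
    proof (cases "t = n \<and> real n \<le> N")
      case True
      then have "real R * real t \<le> 82944 * (N / real n + 1) * real n"
        using Rbig(3) by (auto intro: mult_right_mono)
      also have "\<dots> = 82944 * (N + real n)" using npos by (simp add: field_simps)
      finally show ?thesis using True by simp
    next
      case False
      then have c: "N \<le> real n" "real t \<le> N + 1" using tcase by auto
      then have "\<lceil>N / real n\<rceil> \<le> 1" using npos by (simp add: ceiling_le_iff)
      then have "nat \<lceil>N / real n\<rceil> \<le> 1" by simp
      then have "real R \<le> 82944" using R_def' by simp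
      then have "real R * real t \<le> 82944 * (N + 1)" using c by (intro mult_mono) auto
      then show ?thesis using N by simp
    qed
  qed
  show "82944 * real n \<le> real R * (real t)\<^sup>2 * \<epsilon>\<^sup>2"
  proof (cases "t = n")
    case True
    have "82944 * (N * \<epsilon>\<^sup>2) * real n \<le> real R * real t * \<epsilon>\<^sup>2 * real n"
      using Rt(1) e2 npos by (simp add: mult.assoc[symmetric] mult_right_mono)
    moreover have "1 * real n \<le> N * \<epsilon>\<^sup>2 * real n" 
      using H1 e2 npos by (intro mult_right_mono) (auto simp: N_def)
    ultimately show ?thesis using True by (simp add: power2_eq_square mult_ac)
  next
    case False
    then have "N\<^sup>2 \<le> (real t)\<^sup>2" using tcase N by (intro power_mono) auto
    \<comment> \<open>Short blocks: t \<ge> N gives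
      \<open>(t * \<epsilon>)\<^sup>2 \<ge> H\<^sup>2 \<ge> n\<close>, using \<Lambda> \<ge>
      1.\<close>
    have "H\<^sup>2 * 1 \<le> H\<^sup>2 * (1 / \<epsilon>\<^sup>2)" using e2 by (intro mult_left_mono) auto
    also have "\<dots> = N\<^sup>2 * \<epsilon>\<^sup>2" using e2 by (simp add: N_def field_simps power2_eq_square)
    also have "\<dots> \<le> (real t)\<^sup>2 * \<epsilon>\<^sup>2" using \<open>N\<^sup>2 \<le> (real t)\<^sup>2\<close> by (intro mult_right_mono) auto
    finally have "H\<^sup>2 \<le> (real t)\<^sup>2 * \<epsilon>\<^sup>2" by simp
    moreover have "real n * 1 \<le> real n * \<Lambda>" using \<Lambda> by (intro mult_left_mono) auto
    ultimately have "real n \<le> (real t)\<^sup>2 * \<epsilon>\<^sup>2" using H2 by linarith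
    then have "82944 * real n \<le> real R * ((real t)\<^sup>2 * \<epsilon>\<^sup>2)"
      using Rbig(1) by (intro mult_mono) auto
    then show ?thesis by (simp add: mult.assoc)
  qed
  define A where "A = real n / (real t * \<epsilon>\<^sup>2) + real n / (real t * real R * \<epsilon>^4)"
  have m_def': "m = nat \<lceil>10^8 * ln (real k) * A\<rceil>"
    by (simp add: m_def eval_len_def Let_def A_def t_def R_def)
  have "0 < A" unfolding A_def using pos npos eps by (intro add_pos_pos divide_pos_pos mult_pos_pos) auto
  then have Apos: "0 < 10^8 * ln (real k) * A" using lnk by simp
  note cA = nat_ceiling_bounds[OF Apos, folded m_def']
  show "1 \<le> m" using cA by simp
  show "10^8 * ln (real k) * (real n / (real t * \<epsilon>\<^sup>2) + real n / (real t * real R * \<epsilon>^4)) \<le> real m"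
    using cA by (simp add: A_def)
  \<comment> \<open>The balancing point: \<open>N\<^sup>2 * \<epsilon>^4 = H\<^sup>2\<close> is at
    least n\<Lambda>, so evaluation costs at most a constant times the training budget.\<close>
  have AN: "\<Lambda> * (real n / (N * \<epsilon>^4)) \<le> N"
  proof -
    have "\<Lambda> * (real n / (N * \<epsilon>^4)) = real n * \<Lambda> / (H * \<epsilon>\<^sup>2)"
      using e2 by (simp add: N_def power4_eq_xxxx power2_eq_square)
    also have "\<dots> \<le> H\<^sup>2 / (H * \<epsilon>\<^sup>2)" using H2 e2 H1 by (intro divide_right_mono) auto
    also have "\<dots> = N" using H1 by (simp add: N_def power2_eq_square)
    finally show ?thesis .
  qed
  have e4: "\<epsilon>^4 \<le> \<epsilon>\<^sup>2" using eps by (intro power_decreasing) auto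
  have A1: "real n / (real t * \<epsilon>\<^sup>2) \<le> 1 / \<epsilon>\<^sup>2 + real n / (N * \<epsilon>^4)"
  proof (cases "t = n")
    case True
    then show ?thesis using npos N eps by simp
  next
    case False
    then have "N \<le> real t" using tcase by auto
    then have "real n / (real t * \<epsilon>\<^sup>2) \<le> real n / (N * \<epsilon>^4)"
      using N e4 e2 eps pos by (intro divide_left_mono mult_mono mult_pos_pos) auto
    moreover have "0 \<le> 1 / \<epsilon>\<^sup>2" by simp
    ultimately show ?thesis by linarith
  qed
  have "N * \<epsilon>^4 \<le> real t * real R * \<epsilon>^4"
    using Rt(1) N by (intro mult_right_mono) (auto simp: mult.commute)
  then have A2: "real n / (real t * real R * \<epsilon>^4) \<le> real n / (N * \<epsilon>^4)"
    using N eps pos by (intro divide_left_mono mult_pos_pos) auto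
  have "\<Lambda> * A \<le> \<Lambda> * (1 / \<epsilon>\<^sup>2 + 2 * (real n / (N * \<epsilon>^4)))"
    using A1 A2 \<Lambda> unfolding A_def by (intro mult_left_mono) auto
  also have "\<dots> = \<Lambda> / \<epsilon>\<^sup>2 + 2 * (\<Lambda> * (real n / (N * \<epsilon>^4)))" by (simp add: algebra_simps)
  also have "\<dots> \<le> N + 2 * N"
    using AN H(1) e2 by (intro add_mono) (auto simp: N_def divide_right_mono)
  finally have LA: "\<Lambda> * A \<le> 3 * N" by simp
  \<comment> \<open>Rounding m up costs at most one sample per source; ln k \<ge> 1/2 bounds this
    loss by a multiple of N.\<close>
  have "real k * (1 / 2) \<le> \<Lambda>" unfolding \<Lambda>_def using lnk by (intro mult_left_mono) auto
  then have kN: "real k \<le> 2 * N" using H(1) N1 by linarith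
  have "(real k + 1) * real m \<le> (2 * real k) * (10^8 * ln (real k) * A + 1)"
    using cA k by (intro mult_mono) auto
  also have "\<dots> = 2 * 10^8 * (\<Lambda> * A) + 2 * real k" by (simp add: \<Lambda>_def algebra_simps)
  also have "\<dots> \<le> 2 * 10^8 * (3 * N) + 2 * (2 * N)" using LA kN by (intro add_mono mult_left_mono) auto
  finally have "real R * real t + (real k + 1) * real m \<le> 165888 * N + (2 * 10^8 * (3 * N) + 2 * (2 * N))"
    using Rt(2) by linarith
  \<comment> \<open>The constant 10^9 exceeds 165888 + 6 * 10^8 + 4.\<close>
  also have "\<dots> \<le> 10^9 * N" using N by simp
  finally show "real R * real t + (real k + 1) * real m \<le> 10^9 * hardness n k / \<epsilon>\<^sup>2"
    by (simp add: N_def H_def)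
qed

section \<open>Sample count and final guarantee\<close>

text \<open>Any enumeration of the tags serves, since the answers are independent and are addressed
  by tag.\<close>

definition classifier :: "nat \<Rightarrow> nat \<Rightarrow> real \<Rightarrow> alg" where
  "classifier n k \<epsilon> = (let t = block_len n k \<epsilon>; R = block_count n k \<epsilon>; m = eval_len n k \<epsilon> in
     query_all fst (SOME vs. distinct vs \<and> set vs = train_tags R t \<union> eval_tags k m)
       (guess n R t m))"

text \<open>The sample count is deterministic: Rt for training and m for each of k + 1 sources,
  since P is evaluated afresh as well.\<close>

lemma run_classifier:
  fixes n k :: nat and \<epsilon> :: real
  defines "t \<equiv> block_len n k \<epsilon>" and "R \<equiv> block_count n k \<epsilon>" and "m \<equiv> eval_len n k \<epsilon>"
  shows "run src (classifier n k \<epsilon>)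
    = map_pmf (\<lambda>\<omega>. (guess n R t m \<omega>, R * t + (k + 1) * m))
        (Pi_pmf (train_tags R t \<union> eval_tags k m) 0 (\<lambda>v. src (fst v)))"
proof -
  let ?I = "train_tags R t \<union> eval_tags k m"
  define vs where "vs = (SOME vs. distinct vs \<and> set vs = ?I)"
  have "finite ?I" by (auto simp: train_tags_def eval_tags_def)
  then have "\<exists>vs. distinct vs \<and> set vs = ?I" using finite_distinct_list by blast
  then have vs: "distinct vs" "set vs = ?I"
    unfolding vs_def by (rule someI2_ex; simp)+
  have "length vs = card ?I" using vs distinct_card by metis
  also have "\<dots> = card (train_tags R t) + card (eval_tags k m)"
    by (intro card_Un_disjoint) (auto simp: train_tags_def eval_tags_def)
  also have "\<dots> = R * t + (k + 1) * m"
    by (simp add: train_tags_def eval_tags_def card_cartesian_product)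
  finally have len: "length vs = R * t + (k + 1) * m" .
  have "classifier n k \<epsilon> = query_all fst vs (guess n R t m)"
    by (simp add: classifier_def Let_def vs_def t_def R_def m_def)
  then show ?thesis by (simp only: run_query_all[OF vs(1)] vs(2) len)
qed

theorem theorem3p2:
  shows "\<exists>C::real. C > 0 \<and> (\<exists>A :: nat \<Rightarrow> nat \<Rightarrow> real \<Rightarrow> alg.
    \<forall>n k (\<epsilon>::real) (P::nat pmf).
      k \<ge> 2 \<and> n \<ge> 1 \<and> 0 < \<epsilon> \<and> \<epsilon> \<le> 1 \<and> set_pmf P \<subseteq> {1..n} \<and> dTV n P (unif n) \<ge> \<epsilon> \<longrightarrow>
      (\<forall>b :: nat \<Rightarrow> bool.
         measure_pmf.prob (run (sources n k P b) (A n k \<epsilon>))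
            {(out, c). \<forall>i\<in>{1..k}. out i = b i} \<ge> 8/9
       \<and> (\<forall>out c. (out, c) \<in> set_pmf (run (sources n k P b) (A n k \<epsilon>)) \<longrightarrow>
            (real n \<ge> real k * ln (real k) \<longrightarrow>
               real c \<le> C * sqrt (real n * real k * ln (real k)) / \<epsilon>^2)
          \<and> (real n \<le> real k * ln (real k) \<longrightarrow>
               real c \<le> C * real k * ln (real k) / \<epsilon>^2))))"
proof (intro exI[of _ "10^9 :: real"] exI[of _ classifier] conjI allI impI; (elim conjE)?)
  fix n k :: nat and \<epsilon> :: real and P :: "nat pmf" and b :: "nat \<Rightarrow> bool"
  assume a: "2 \<le> k" "1 \<le> n" "0 < \<epsilon>" "\<epsilon> \<le> 1" "set_pmf P \<subseteq> {1..n}" "\<epsilon> \<le> dTV n P (unif n)"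
  define t where "t = block_len n k \<epsilon>"
  define R where "R = block_count n k \<epsilon>"
  define m where "m = eval_len n k \<epsilon>"
  note par = parameters[OF a(2,1,3,4), folded t_def R_def m_def]
  note run = run_classifier[of "sources n k P b" n k \<epsilon>, folded t_def R_def m_def]
  let ?M = "Pi_pmf (train_tags R t \<union> eval_tags k m) 0 (\<lambda>v. sources n k P b (fst v))"
  let ?bad = "{\<omega>. \<exists>i\<in>{1..k}. guess n R t m \<omega> i \<noteq> b i}"
  have "measure_pmf.prob ?M ?bad \<le> 1 / 9"
    by (rule prob_guess_wrong[OF a(2,1,3,4,5,6) par(1-6)])
  moreover have "measure_pmf.prob ?M (- ?bad) = 1 - measure_pmf.prob ?M ?bad"
    using measure_pmf.prob_compl[of ?bad ?M] by (simp add: Compl_eq_Diff_UNIV)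
  moreover have "(\<lambda>\<omega>. (guess n R t m \<omega>, R * t + (k + 1) * m)) -` {(out, c). \<forall>i\<in>{1..k}. out i = b i} = - ?bad"
    by auto
  ultimately show "8 / 9 \<le> measure_pmf.prob (run (sources n k P b) (classifier n k \<epsilon>))
      {(out, c). \<forall>i\<in>{1..k}. out i = b i}"
    unfolding run by simp
  fix out c
  assume "(out, c) \<in> set_pmf (run (sources n k P b) (classifier n k \<epsilon>))"
  then have "c = R * t + (k + 1) * m" unfolding run by auto
  then have c: "real c \<le> 10^9 * hardness n k / \<epsilon>\<^sup>2" using par(7) by (simp add: algebra_simps)
  have L: "0 \<le> real k * ln (real k)" using a by simp
  show "real c \<le> 10^9 * sqrt (real n * real k * ln (real k)) / \<epsilon>\<^sup>2" if "real k * ln (real k) \<le> real n"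
  proof -
    \<comment> \<open>In this regime the maximum in \<open>hardness\<close> is the square root; in
      the other regime it is k ln k.\<close>
    have "real k * ln (real k) = sqrt ((real k * ln (real k)) * (real k * ln (real k)))" using L by simp
    also have "\<dots> \<le> sqrt (real n * (real k * ln (real k)))"
      using that L by (intro real_sqrt_le_mono mult_right_mono)
    finally show ?thesis using c by (simp add: hardness_def max_absorb1 mult.assoc)
  qed
  show "real c \<le> 10^9 * real k * ln (real k) / \<epsilon>\<^sup>2" if "real n \<le> real k * ln (real k)"
  proof -
    have "sqrt (real n * (real k * ln (real k))) \<le> sqrt ((real k * ln (real k)) * (real k * ln (real k)))"
      using that L by (intro real_sqrt_le_mono mult_right_mono)
    also have "\<dots> = real k * ln (real k)" using L by simp
    finally show ?thesis using c by (simp add: hardness_def max_absorb2 mult.assoc)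
  qed
qed simp

end
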